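(* Let $V$ be an irreducible uniformly bounded Harish-Chandra module for $(\tilde{\mathcal{H}}_N\ltimes A_N)\otimes B$ on which $t^{\mathbf{0}}$ acts non-trivially and $t^{\mathbf{s}}$ acts non-trivially for some $\mathbf{s}\ne\mathbf{0}$. Let $\psi:B\to\mathbb{C}$ be the algebra homomorphism with $t^{\mathbf{r}}b=\psi(b)t^{\mathbf{r}}$ on $V$ for all $\mathbf{r}\neq\mathbf{0}$, $b\in B$. Then the elements $D(\overline{\mathbf{r}},\mathbf{r})b$ act as $\psi(b)D(\overline{\mathbf{r}},\mathbf{r})$ on $V$, for all $\mathbf{r}\in\mathbb{Z}^N$ and $b\in B$.
   Context: All vector spaces, algebras and tensor products are over $\mathbb{C}$; $B$ is a finitely generated commutative associative unital algebra; $N=2m$ with $m$ a positive integer. $A_N=\mathbb{C}[t_1^{\pm1},\dots,t_N^{\pm1}]$, $t^{\mathbf{n}}=t_1^{n_1}\cdots t_N^{n_N}$, $d_i=t_i\frac{d}{dt_i}$, $(x,y)=\sum_ix_iy_i$. For $u\in\mathbb{C}^N$, $\mathbf{r}\in\mathbb{Z}^N$ put $D(u,\mathbf{r})=\sum_iu_it^{\mathbf{r}}d_i$, with $[D(u,\mathbf{r}),D(v,\mathbf{s})]=D((u,\mathbf{s})v-(v,\mathbf{r})u,\mathbf{r}+\mathbf{s})$. For $\mathbf{r}\in\mathbb{Z}^N$ put $\overline{\mathbf{r}}=(r_{m+1},\dots,r_{2m},-r_1,\dots,-r_m)$. $\mathcal{H}_N=\mathrm{span}\{D(\overline{\mathbf{r}},\mathbf{r})\mid\mathbf{r}\in\mathbb{Z}^N\}$,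 $\mathfrak{h}=\mathrm{span}\{d_1,\dots,d_N\}$, $\tilde{\mathcal{H}}_N=\mathcal{H}_N\rtimes\mathfrak{h}$. In $\tilde{\mathcal{H}}_N\ltimes A_N$, $A_N$ is an abelian ideal and $[D(u,\mathbf{r}),t^{\mathbf{s}}]=(u,\mathbf{s})t^{\mathbf{r}+\mathbf{s}}$. For a Lie algebra $\mathfrak{g}$, $\mathfrak{g}\otimes B$ has bracket $[x\otimes b_1,y\otimes b_2]=[x,y]\otimes b_1b_2$; write $xb=x\otimes b$ and $x=x\otimes1$. A uniformly bounded Harish-Chandra module is a module $V=\bigoplus_{\lambda\in\mathfrak{h}^*}V_\lambda$, $V_\lambda=\{v\mid hv=\lambda(h)v\ \forall h\in\mathfrak{h}\}$, for which there is a positive integer $M$ with $\dim V_\lambda\le M$ for all $\lambda$. Under the hypotheses of the claim a homomorphism $\psi$ as described exists and is unique. *)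

theory Defs
  imports "HOL-Analysis.Analysis" "HOL-Library.Poly_Mapping"
begin

section \<open>Complex vector spaces, commutative algebras and Lie algebras\<close>

class complex_vector = ab_group_add +
  fixes scaleC :: "complex \<Rightarrow> 'a \<Rightarrow> 'a" (infixr "*\<^sub>C" 75)
  assumes scaleC_add_right: "a *\<^sub>C (x + y) = a *\<^sub>C x + a *\<^sub>C y"
    and scaleC_add_left: "(a + b) *\<^sub>C x = a *\<^sub>C x + b *\<^sub>C x"
    and scaleC_scaleC: "a *\<^sub>C (b *\<^sub>C x) = (a * b) *\<^sub>C x"
    and scaleC_one: "1 *\<^sub>C x = x"

class complex_comm_algebra = comm_ring_1 + complex_vector +
  assumes mult_scaleC_left: "(a *\<^sub>C x) * y = a *\<^sub>C (x * y)"

class complex_lie_algebra = complex_vector +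
  fixes lie_bracket :: "'a \<Rightarrow> 'a \<Rightarrow> 'a"
  assumes lie_add_left: "lie_bracket (x + y) z = lie_bracket x z + lie_bracket y z"
    and lie_add_right: "lie_bracket x (y + z) = lie_bracket x y + lie_bracket x z"
    and lie_scaleC_left: "lie_bracket (a *\<^sub>C x) y = a *\<^sub>C lie_bracket x y"
    and lie_scaleC_right: "lie_bracket x (a *\<^sub>C y) = a *\<^sub>C lie_bracket x y"
    and lie_self: "lie_bracket x x = 0"
    and lie_jacobi: "lie_bracket x (lie_bracket y z) + lie_bracket y (lie_bracket z x)
        + lie_bracket z (lie_bracket x y) = 0"

global_interpretation cvec: vector_space "scaleC :: complex \<Rightarrow> 'a \<Rightarrow> 'a::complex_vector"
  by unfold_locales (simp_all add: scaleC_add_right scaleC_add_left scaleC_scaleC scaleC_one)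

abbreviation clinear :: "('a::complex_vector \<Rightarrow> 'b::complex_vector) \<Rightarrow> bool"
  where "clinear \<equiv> Vector_Spaces.linear scaleC scaleC"

lemma clinear_iff:
  "clinear f \<longleftrightarrow> (\<forall>x y. f (x + y) = f x + f y) \<and> (\<forall>c x. f (c *\<^sub>C x) = c *\<^sub>C f x)"
  by (auto simp: Vector_Spaces.linear_def module_hom_def module_hom_axioms_def
      cvec.vector_space_axioms cvec.module_axioms)

lemma clinear_sum: "clinear f \<Longrightarrow> f (sum g A) = (\<Sum>a\<in>A. f (g a))"
  by (rule module_hom.sum[of scaleC scaleC]) (simp add: module_hom_iff_linear)

lemma clinear_0: "clinear f \<Longrightarrow> f 0 = 0"
  by (metis add_cancel_right_right clinear_iff)

lemma clinear_diff: "clinear f \<Longrightarrow> f (x - y) = f x - f y"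
  by (metis add_diff_cancel_right' clinear_iff diff_add_cancel)

instantiation complex :: complex_comm_algebra
begin
definition scaleC_complex :: "complex \<Rightarrow> complex \<Rightarrow> complex"
  where "scaleC_complex c x = c * x"
instance by standard (simp_all add: scaleC_complex_def algebra_simps)
end

instantiation vec :: (complex_vector, finite) complex_vector
begin
definition scaleC_vec :: "complex \<Rightarrow> 'a ^ 'b \<Rightarrow> 'a ^ 'b"
  where "scaleC_vec c x = (\<chi> i. c *\<^sub>C (x $ i))"
instance by standard
    (simp_all add: scaleC_vec_def vec_eq_iff scaleC_add_right scaleC_add_left scaleC_scaleC scaleC_one)
end

lemma scaleC_vec_nth [simp]: "(c *\<^sub>C x) $ i = c *\<^sub>C (x $ i)"
  by (simp add: scaleC_vec_def)

instantiation poly_mapping :: (type, complex_vector) complex_vector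
begin
definition scaleC_poly_mapping :: "complex \<Rightarrow> ('a \<Rightarrow>\<^sub>0 'b) \<Rightarrow> ('a \<Rightarrow>\<^sub>0 'b)"
  where "scaleC_poly_mapping c f = Poly_Mapping.map (scaleC c) f"
lemma lookup_scaleC [simp]:
  "Poly_Mapping.lookup (c *\<^sub>C f) k = c *\<^sub>C Poly_Mapping.lookup f (k :: 'a)"
  by (simp add: scaleC_poly_mapping_def Poly_Mapping.map.rep_eq when_def)
instance by standard
    (auto intro!: poly_mapping_eqI
      simp: lookup_add scaleC_add_right scaleC_add_left scaleC_scaleC scaleC_one)
end

definition finitely_generated_algebra :: "'b::complex_comm_algebra itself \<Rightarrow> bool"
  where "finitely_generated_algebra _ \<longleftrightarrow>
    (\<exists>S. finite S \<and>
      (\<lambda>A. cvec.subspace A \<and> 1 \<in> A \<and> (\<forall>x\<in>A. \<forall>y\<in>A. x * y \<in> A)) hull S = (UNIV :: 'b set))"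

definition algebra_hom :: "('a::complex_comm_algebra \<Rightarrow> 'b::complex_comm_algebra) \<Rightarrow> bool"
  where "algebra_hom f \<longleftrightarrow> clinear f \<and> f 1 = 1 \<and> (\<forall>x y. f (x * y) = f x * f y)"


section \<open>The tensor product of complex vector spaces\<close>

definition tensor_relations :: "('a::complex_vector \<times> 'b::complex_vector \<Rightarrow>\<^sub>0 complex) set"
  where "tensor_relations =
     {Poly_Mapping.single (x + x', b) 1 - Poly_Mapping.single (x, b) 1
        - Poly_Mapping.single (x', b) 1 | x x' b. True}
   \<union> {Poly_Mapping.single (x, b + b') 1 - Poly_Mapping.single (x, b) 1
        - Poly_Mapping.single (x, b') 1 | x b b'. True}
   \<union> {Poly_Mapping.single (c *\<^sub>C x, b) 1 - c *\<^sub>C Poly_Mapping.single (x, b) 1 | c x b. True}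
   \<union> {Poly_Mapping.single (x, c *\<^sub>C b) 1 - c *\<^sub>C Poly_Mapping.single (x, b) 1 | c x b. True}"

definition tensor_rel :: "('a::complex_vector \<times> 'b::complex_vector \<Rightarrow>\<^sub>0 complex) \<Rightarrow>
    ('a \<times> 'b \<Rightarrow>\<^sub>0 complex) \<Rightarrow> bool"
  where "tensor_rel f g \<longleftrightarrow> f - g \<in> cvec.span tensor_relations"

lemma equivp_tensor_rel:
  "equivp (tensor_rel :: ('a::complex_vector \<times> 'b::complex_vector \<Rightarrow>\<^sub>0 complex) \<Rightarrow> _ \<Rightarrow> bool)"
    (is "equivp ?R")
proof (rule equivpI)
  show "reflp ?R"
    by (simp add: reflp_def tensor_rel_def cvec.span_zero)
  show "symp ?R"
    unfolding symp_def tensor_rel_def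
    using cvec.span_neg minus_diff_eq by fastforce
  show "transp ?R"
    unfolding transp_def tensor_rel_def
  proof (intro allI impI)
    fix f g h :: "('a \<times> 'b) \<Rightarrow>\<^sub>0 complex"
    assume "f - g \<in> cvec.span tensor_relations" "g - h \<in> cvec.span tensor_relations"
    from cvec.span_add[OF this] show "f - h \<in> cvec.span tensor_relations" by simp
  qed
qed

quotient_type (overloaded) ('a, 'b) tensor =
  "('a::complex_vector \<times> 'b::complex_vector) \<Rightarrow>\<^sub>0 complex" / tensor_rel
  by (rule equivp_tensor_rel)

instantiation tensor :: (complex_vector, complex_vector) complex_vector
begin

lift_definition zero_tensor :: "('a, 'b) tensor" is 0 .

lift_definition plus_tensor :: "('a, 'b) tensor \<Rightarrow> ('a, 'b) tensor \<Rightarrow> ('a, 'b) tensor" is "(+)"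
  unfolding tensor_rel_def by (simp add: add_diff_add cvec.span_add)

lift_definition uminus_tensor :: "('a, 'b) tensor \<Rightarrow> ('a, 'b) tensor" is uminus
  unfolding tensor_rel_def by (simp only: minus_diff_minus cvec.span_neg)

lift_definition minus_tensor :: "('a, 'b) tensor \<Rightarrow> ('a, 'b) tensor \<Rightarrow> ('a, 'b) tensor" is "(-)"
  subgoal premises prems for f f' g g'
  proof -
    have "f - g - (f' - g') = (f - f') - (g - g')" by simp
    then show ?thesis using prems unfolding tensor_rel_def by (simp only: cvec.span_diff)
  qed
  done

lift_definition scaleC_tensor :: "complex \<Rightarrow> ('a, 'b) tensor \<Rightarrow> ('a, 'b) tensor" is scaleC
  unfolding tensor_rel_def
  by (simp only: cvec.scale_right_diff_distrib[symmetric] cvec.span_scale)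

instance
  by standard
    (transfer; simp add: tensor_rel_def cvec.span_zero scaleC_add_right scaleC_add_left
       scaleC_scaleC scaleC_one algebra_simps)+
end

lift_definition pure_tensor :: "'a::complex_vector \<Rightarrow> 'b::complex_vector \<Rightarrow> ('a, 'b) tensor"
    (infixl "\<otimes>\<^sub>C" 70)
  is "\<lambda>x b. Poly_Mapping.single (x, b) 1" .

lemma tensor_add_left: "(x + x') \<otimes>\<^sub>C b = x \<otimes>\<^sub>C b + x' \<otimes>\<^sub>C b"
  by transfer (unfold tensor_rel_def, rule cvec.span_base, unfold tensor_relations_def,
      simp add: diff_diff_add[symmetric], blast)

lemma tensor_add_right: "x \<otimes>\<^sub>C (b + b') = x \<otimes>\<^sub>C b + x \<otimes>\<^sub>C b'"
  by transfer (unfold tensor_rel_def, rule cvec.span_base, unfold tensor_relations_def,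
      simp add: diff_diff_add[symmetric], blast)

lemma tensor_scaleC_left: "(c *\<^sub>C x) \<otimes>\<^sub>C b = c *\<^sub>C (x \<otimes>\<^sub>C b)"
  by transfer (unfold tensor_rel_def, rule cvec.span_base, unfold tensor_relations_def, blast)

lemma tensor_scaleC_right: "x \<otimes>\<^sub>C (c *\<^sub>C b) = c *\<^sub>C (x \<otimes>\<^sub>C b)"
  by transfer (unfold tensor_rel_def, rule cvec.span_base, unfold tensor_relations_def, blast)

text \<open>Linear extension of a function on the basis of a free vector space.\<close>

definition lin_ext :: "('k \<Rightarrow> 'c::complex_vector) \<Rightarrow> ('k \<Rightarrow>\<^sub>0 complex) \<Rightarrow> 'c"
  where "lin_ext h f = (\<Sum>p\<in>Poly_Mapping.keys f. Poly_Mapping.lookup f p *\<^sub>C h p)"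

lemma lin_ext_superset:
  assumes "finite A" "Poly_Mapping.keys f \<subseteq> A"
  shows "lin_ext h f = (\<Sum>p\<in>A. Poly_Mapping.lookup f p *\<^sub>C h p)"
  unfolding lin_ext_def
  by (rule sum.mono_neutral_left) (use assms in \<open>auto simp: in_keys_iff\<close>)

lemma clinear_lin_ext: "clinear (lin_ext h)"
proof -
  have "lin_ext h (f + g) = lin_ext h f + lin_ext h g" for f g
  proof -
    let ?A = "Poly_Mapping.keys f \<union> Poly_Mapping.keys g"
    have "Poly_Mapping.keys (f + g) \<subseteq> ?A" by (rule Poly_Mapping.keys_add)
    then show ?thesis
      by (simp add: lin_ext_superset[of ?A] lookup_add scaleC_add_left sum.distrib)
  qed
  moreover have "lin_ext h (c *\<^sub>C f) = c *\<^sub>C lin_ext h f" for c f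
  proof -
    have "Poly_Mapping.keys (c *\<^sub>C f) \<subseteq> Poly_Mapping.keys f"
      by (auto simp: in_keys_iff)
    then show ?thesis
      by (simp add: lin_ext_superset[of "Poly_Mapping.keys f"] cvec.scale_sum_right
          scaleC_scaleC scaleC_complex_def)
  qed
  ultimately show ?thesis by (simp add: clinear_iff)
qed

lemma lin_ext_single [simp]: "lin_ext h (Poly_Mapping.single p c) = c *\<^sub>C h p"
  by (simp add: lin_ext_superset[of "{p}"])

definition cbilinear :: "('a::complex_vector \<Rightarrow> 'b::complex_vector \<Rightarrow> 'c::complex_vector) \<Rightarrow> bool"
  where "cbilinear h \<longleftrightarrow> (\<forall>b. clinear (\<lambda>x. h x b)) \<and> (\<forall>x. clinear (h x))"

text \<open>The linear map on the tensor product induced by a bilinear map; it is meaningful only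
  for bilinear \<open>h\<close>, since otherwise it depends on the chosen representative.\<close>

definition tensor_lift :: "('a::complex_vector \<Rightarrow> 'b::complex_vector \<Rightarrow> 'c::complex_vector) \<Rightarrow>
    ('a, 'b) tensor \<Rightarrow> 'c"
  where "tensor_lift h t = lin_ext (\<lambda>p. h (fst p) (snd p)) (rep_tensor t)"

lemma lin_ext_tensor_rel:
  assumes "cbilinear h" "tensor_rel f g"
  shows "lin_ext (\<lambda>p. h (fst p) (snd p)) f = lin_ext (\<lambda>p. h (fst p) (snd p)) g"
proof -
  let ?L = "lin_ext (\<lambda>p. h (fst p) (snd p))"
  have sub: "cvec.subspace {f. ?L f = 0}"
    using clinear_lin_ext[of "\<lambda>p. h (fst p) (snd p)"]
    by (auto simp: cvec.subspace_def clinear_iff clinear_0)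
  have b: "h (x + x') b = h x b + h x' b" "h x (b + b') = h x b + h x b'"
     "h (c *\<^sub>C x) b = c *\<^sub>C h x b" "h x (c *\<^sub>C b) = c *\<^sub>C h x b" for x x' b b' c
    using assms(1) unfolding cbilinear_def clinear_iff by blast+
  have lin: "?L (u - v) = ?L u - ?L v" "?L (c *\<^sub>C u) = c *\<^sub>C ?L u" for u v c
    using clinear_lin_ext clinear_diff clinear_iff by blast+
  have "tensor_relations \<subseteq> {f. ?L f = 0}"
    unfolding tensor_relations_def by (auto simp: lin b scaleC_one)
  then have "cvec.span tensor_relations \<subseteq> {f. ?L f = 0}"
    using sub by (rule cvec.span_minimal)
  then have "?L (f - g) = 0" using assms(2) unfolding tensor_rel_def by blast
  then show ?thesis using lin by simp
qed

lemma tensor_lift_abs: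
  assumes "cbilinear h"
  shows "tensor_lift h (abs_tensor f) = lin_ext (\<lambda>p. h (fst p) (snd p)) f"
  unfolding tensor_lift_def
  by (rule lin_ext_tensor_rel[OF assms])
     (rule rep_abs_rsp_left[OF Quotient3_tensor], rule equivp_reflp[OF equivp_tensor_rel])

lemma tensor_lift_pure [simp]: "cbilinear h \<Longrightarrow> tensor_lift h (x \<otimes>\<^sub>C b) = h x b"
  by (simp add: pure_tensor.abs_eq tensor_lift_abs scaleC_one)

lemma clinear_tensor_lift:
  assumes "cbilinear h"
  shows "clinear (tensor_lift h)"
proof -
  note lin = clinear_lin_ext[of "\<lambda>p. h (fst p) (snd p)", unfolded clinear_iff]
  have "tensor_lift h (s + t) = tensor_lift h s + tensor_lift h t" for s t
    by (induct s rule: tensor.abs_induct, induct t rule: tensor.abs_induct)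
      (simp add: plus_tensor.abs_eq tensor_lift_abs[OF assms] lin)
  moreover have "tensor_lift h (c *\<^sub>C s) = c *\<^sub>C tensor_lift h s" for c s
    by (induct s rule: tensor.abs_induct)
      (simp add: scaleC_tensor.abs_eq tensor_lift_abs[OF assms] lin)
  ultimately show ?thesis by (simp add: clinear_iff)
qed

lemma clinear_abs_tensor: "clinear abs_tensor"
  by (simp add: clinear_iff plus_tensor.abs_eq scaleC_tensor.abs_eq)

lemma abs_tensor_eq_sum:
  "abs_tensor f = (\<Sum>p\<in>Poly_Mapping.keys f. (Poly_Mapping.lookup f p *\<^sub>C fst p) \<otimes>\<^sub>C snd p)"
proof -
  have "f = (\<Sum>p\<in>Poly_Mapping.keys f. Poly_Mapping.lookup f p *\<^sub>C Poly_Mapping.single p 1)"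
    by (rule poly_mapping_eqI)
      (simp add: lookup_sum lookup_single scaleC_complex_def when_def in_keys_iff
        if_distrib[of "\<lambda>y. _ * y"] sum.delta cong: if_cong)
  then have "abs_tensor f = abs_tensor
      (\<Sum>p\<in>Poly_Mapping.keys f. Poly_Mapping.lookup f p *\<^sub>C Poly_Mapping.single p 1)"
    by (rule arg_cong)
  also have "\<dots> = (\<Sum>p\<in>Poly_Mapping.keys f. Poly_Mapping.lookup f p *\<^sub>C abs_tensor (Poly_Mapping.single p 1))"
    by (simp only: clinear_sum[OF clinear_abs_tensor] scaleC_tensor.abs_eq)
  also have "\<dots> = (\<Sum>p\<in>Poly_Mapping.keys f. (Poly_Mapping.lookup f p *\<^sub>C fst p) \<otimes>\<^sub>C snd p)"
    unfolding tensor_scaleC_left by (simp add: pure_tensor.abs_eq)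
  finally show ?thesis .
qed

lemma tensor_induct [case_names zero add]:
  assumes "P 0" "\<And>x b t. P t \<Longrightarrow> P (x \<otimes>\<^sub>C b + t)"
  shows "P t"
proof -
  have "P (\<Sum>p\<in>A. g p \<otimes>\<^sub>C h p)" if "finite A" for A :: "('a \<times> 'b) set" and g h
    using that by (induct A) (simp_all add: assms)
  then have "P (abs_tensor f)" for f
    unfolding abs_tensor_eq_sum by simp
  then show ?thesis by (induct t rule: tensor.abs_induct)
qed

lemma tensor_lift_add_pure:
  "cbilinear h \<Longrightarrow> tensor_lift h (x \<otimes>\<^sub>C b + t) = h x b + tensor_lift h t"
  using clinear_tensor_lift[of h] by (simp add: clinear_iff)


section \<open>The Lie algebra structure on the tensor product with a commutative algebra\<close>

lemma mult_scaleC_right: "x * (c *\<^sub>C y) = c *\<^sub>C (x * (y :: 'a::complex_comm_algebra))"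
  by (metis mult.commute mult_scaleC_left)

lemma cbilinear_tensor_bracket_inner:
  "cbilinear (\<lambda>(y::'a::complex_lie_algebra) (c::'b::complex_comm_algebra).
     lie_bracket x y \<otimes>\<^sub>C (b * c))"
  by (simp add: cbilinear_def clinear_iff lie_add_right lie_scaleC_right tensor_add_left
      tensor_scaleC_left tensor_add_right tensor_scaleC_right distrib_left mult_scaleC_right)

lemma cbilinear_tensor_bracket_outer:
  "cbilinear (\<lambda>(x::'a::complex_lie_algebra) (b::'b::complex_comm_algebra).
     tensor_lift (\<lambda>y c. lie_bracket x y \<otimes>\<^sub>C (b * c)) t)"
proof (induct t rule: tensor_induct)
  case zero
  show ?case
    by (simp add: cbilinear_def clinear_iff
        clinear_0[OF clinear_tensor_lift[OF cbilinear_tensor_bracket_inner]])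
next
  case (add y c t)
  then show ?case
    by (simp add: cbilinear_def clinear_iff
        tensor_lift_add_pure[OF cbilinear_tensor_bracket_inner]
        lie_add_left lie_scaleC_left tensor_add_left tensor_scaleC_left tensor_add_right
        tensor_scaleC_right distrib_right mult_scaleC_left scaleC_add_right)
qed

instantiation tensor :: (complex_lie_algebra, complex_comm_algebra) complex_lie_algebra
begin

definition lie_bracket_tensor :: "('a, 'b) tensor \<Rightarrow> ('a, 'b) tensor \<Rightarrow> ('a, 'b) tensor"
  where "lie_bracket_tensor s t =
    tensor_lift (\<lambda>x b. tensor_lift (\<lambda>y c. lie_bracket x y \<otimes>\<^sub>C (b * c)) t) s"

lemma lie_bracket_pure:
  "lie_bracket (x \<otimes>\<^sub>C b) (y \<otimes>\<^sub>C c) = lie_bracket (x::'a) y \<otimes>\<^sub>C (b * (c::'b))"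
  unfolding lie_bracket_tensor_def
  by (subst tensor_lift_pure[OF cbilinear_tensor_bracket_outer])
     (rule tensor_lift_pure[OF cbilinear_tensor_bracket_inner])

instance
proof
  fix x y z :: "('a, 'b) tensor" and a :: complex
  show left: "lie_bracket (x + y) z = lie_bracket x z + lie_bracket y z" for x y z :: "('a, 'b) tensor"
    using clinear_tensor_lift[OF cbilinear_tensor_bracket_outer]
    unfolding lie_bracket_tensor_def clinear_iff by blast
  show sleft: "lie_bracket (a *\<^sub>C x) y = a *\<^sub>C lie_bracket x y" for a and x y :: "('a, 'b) tensor"
    using clinear_tensor_lift[OF cbilinear_tensor_bracket_outer]
    unfolding lie_bracket_tensor_def clinear_iff by blast
  have zleft: "lie_bracket 0 y = 0" for y :: "('a, 'b) tensor"
    using sleft[of 0 0] by simp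
  have pure: "lie_bracket (x \<otimes>\<^sub>C b) t = tensor_lift (\<lambda>y c. lie_bracket x y \<otimes>\<^sub>C (b * c)) t"
    for x :: 'a and b :: 'b and t
    by (simp only: lie_bracket_tensor_def tensor_lift_pure[OF cbilinear_tensor_bracket_outer])
  note inner = clinear_tensor_lift[OF cbilinear_tensor_bracket_inner]
  note inner = inner[unfolded clinear_iff, THEN conjunct1, rule_format]
    inner[unfolded clinear_iff, THEN conjunct2, rule_format]
  show right: "lie_bracket x (y + z) = lie_bracket x y + lie_bracket x z"
    for x y z :: "('a, 'b) tensor"
  proof (induct x rule: tensor_induct)
    case (add x b t)
    then show ?case by (simp add: left pure inner)
  qed (simp add: zleft)
  show sright: "lie_bracket x (a *\<^sub>C y) = a *\<^sub>C lie_bracket x y"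
    for a and x y :: "('a, 'b) tensor"
  proof (induct x rule: tensor_induct)
    case (add x b t)
    then show ?case by (simp add: left pure inner scaleC_add_right)
  qed (simp add: zleft)
  have zright: "lie_bracket y 0 = 0" for y :: "('a, 'b) tensor"
    using sright[of y 0 0] by simp
  have anti0: "lie_bracket x y + lie_bracket y x = 0" for x y :: 'a
    using lie_self[of "x + y"] unfolding lie_add_left lie_add_right by (simp add: lie_self add.commute)
  have tzl: "(0::'a) \<otimes>\<^sub>C b = 0" for b :: 'b
    using tensor_scaleC_left[of 0 "0::'a" b] by simp
  have anti: "lie_bracket s t + lie_bracket t s = 0" for s t :: "('a, 'b) tensor"
  proof (induct s rule: tensor_induct)
    case (add x b s)
    have "lie_bracket (x \<otimes>\<^sub>C b) t + lie_bracket t (x \<otimes>\<^sub>C b) = 0"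
    proof (induct t rule: tensor_induct)
      case (add y c t)
      have "lie_bracket (x \<otimes>\<^sub>C b) (y \<otimes>\<^sub>C c) + lie_bracket (y \<otimes>\<^sub>C c) (x \<otimes>\<^sub>C b) = 0"
        by (simp add: lie_bracket_pure mult.commute[of c b] tensor_add_left[symmetric] anti0 tzl)
      then show ?case using add
        by (simp add: left right add_eq_0_iff)
    qed (simp add: zleft zright)
    then show ?case using add
      by (simp add: left right add_eq_0_iff)
  qed (simp add: zleft zright)
  show "lie_bracket x x = 0"
  proof -
    have "(1 + 1) *\<^sub>C lie_bracket x x = 0"
      by (simp only: scaleC_add_left scaleC_one anti)
    then show ?thesis by simp
  qed
  let ?J = "\<lambda>x y z :: ('a, 'b) tensor. lie_bracket x (lie_bracket y z)
      + lie_bracket y (lie_bracket z x) + lie_bracket z (lie_bracket x y)"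
  have J: "?J (x + x') y z = ?J x y z + ?J x' y z" "?J x (y + x') z = ?J x y z + ?J x x' z"
    "?J x y (z + x') = ?J x y z + ?J x y x'" for x y z x'
    by (simp_all add: left right)
  show "?J x y z = 0"
  proof (induct x rule: tensor_induct)
    case (add x1 b1 x)
    have "?J (x1 \<otimes>\<^sub>C b1) y z = 0"
    proof (induct y rule: tensor_induct)
      case (add x2 b2 y)
      have "?J (x1 \<otimes>\<^sub>C b1) (x2 \<otimes>\<^sub>C b2) z = 0"
      proof (induct z rule: tensor_induct)
        case (add x3 b3 z)
        have b: "b2 * (b3 * b1) = b1 * (b2 * b3)" "b3 * (b1 * b2) = b1 * (b2 * b3)"
          by (simp_all add: ac_simps)
        have "?J (x1 \<otimes>\<^sub>C b1) (x2 \<otimes>\<^sub>C b2) (x3 \<otimes>\<^sub>C b3) = 0"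
          unfolding lie_bracket_pure b by (simp add: tensor_add_left[symmetric] lie_jacobi tzl)
        with add show ?case by (simp only: J add_0)
      qed (simp add: zleft zright)
      with add show ?case by (simp only: J add_0)
    qed (simp add: zleft zright)
    with add show ?case by (simp only: J add_0)
  qed (simp add: zleft zright)
qed

end


section \<open>Vector fields on the torus acting on Laurent polynomials\<close>

text \<open>\<open>A\<^sub>N\<close> is the group algebra of \<open>\<int>\<^sup>N\<close>, and a vector field \<open>\<Sum>\<^sub>i f\<^sub>i d\<^sub>i\<close> is stored as the tuple
  of its coefficients.\<close>

type_synonym 'n laurent = "int ^ 'n \<Rightarrow>\<^sub>0 complex"
type_synonym 'n vector_field = "('n laurent) ^ 'n"

lift_definition tderiv :: "'n::finite \<Rightarrow> 'n laurent \<Rightarrow> 'n laurent"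
  is "\<lambda>i f r. of_int (r $ i) * f r"
  by (rule finite_subset[rotated]) auto

definition vf_apply :: "'n::finite vector_field \<Rightarrow> 'n laurent \<Rightarrow> 'n laurent"
  where "vf_apply X f = (\<Sum>i\<in>UNIV. X $ i * tderiv i f)"

definition vf_bracket :: "'n::finite vector_field \<Rightarrow> 'n vector_field \<Rightarrow> 'n vector_field"
  where "vf_bracket X Y = (\<chi> j. vf_apply X (Y $ j) - vf_apply Y (X $ j))"

definition vf_D :: "complex ^ 'n \<Rightarrow> int ^ 'n \<Rightarrow> 'n::finite vector_field"
  where "vf_D u r = (\<chi> i. Poly_Mapping.single r (u $ i))"

definition pairing :: "complex ^ 'n \<Rightarrow> int ^ 'n \<Rightarrow> complex"
  where "pairing u r = (\<Sum>i\<in>UNIV. u $ i * of_int (r $ i))"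

lemma laurent_induct [case_names zero add]:
  assumes "P 0" "\<And>k c f. P f \<Longrightarrow> P (Poly_Mapping.single k c + f)"
  shows "P (f :: 'k \<Rightarrow>\<^sub>0 complex)"
proof -
  have "P (\<Sum>p\<in>A. Poly_Mapping.single p (h p))" if "finite A" for A :: "'k set" and h
    using that by (induct A) (simp_all add: assms)
  moreover have "f = (\<Sum>p\<in>Poly_Mapping.keys f. Poly_Mapping.single p (Poly_Mapping.lookup f p))"
    by (rule poly_mapping_eqI)
      (simp add: lookup_sum lookup_single when_def in_keys_iff sum.delta)
  ultimately show ?thesis by (metis finite_keys)
qed

lemma scaleC_mult_laurent: "(c *\<^sub>C f) * g = c *\<^sub>C (f * (g :: 'n::finite laurent))"
proof -
  have *: "c *\<^sub>C f = Poly_Mapping.single 0 c * f" for f :: "'n laurent"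
  proof (induct f rule: laurent_induct)
    case (add k d f)
    have "c *\<^sub>C Poly_Mapping.single k d = Poly_Mapping.single 0 c * Poly_Mapping.single k d"
      by (rule poly_mapping_eqI) (simp add: mult_single lookup_single when_def scaleC_complex_def)
    with add show ?case by (simp add: scaleC_add_right distrib_left)
  qed simp
  show ?thesis by (simp add: * mult.assoc)
qed

lemma tderiv_add: "tderiv i (f + g) = tderiv i f + tderiv i g"
  by (rule poly_mapping_eqI) (simp add: tderiv.rep_eq lookup_add distrib_left)

lemma tderiv_scaleC: "tderiv i (c *\<^sub>C f) = c *\<^sub>C tderiv i f"
  by (rule poly_mapping_eqI) (simp add: tderiv.rep_eq scaleC_complex_def)

lemma tderiv_single:
  "tderiv i (Poly_Mapping.single r c) = Poly_Mapping.single r (of_int (r $ i) * c)"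
  by (rule poly_mapping_eqI) (simp add: tderiv.rep_eq lookup_single when_def)

lemma clinear_tderiv: "clinear (tderiv i)"
  by (simp add: clinear_iff tderiv_add tderiv_scaleC)

lemma tderiv_mult: "tderiv i (f * g) = tderiv i f * g + f * tderiv i g"
proof (induct f rule: laurent_induct)
  case (add k c f)
  have "tderiv i (Poly_Mapping.single k c * g)
      = tderiv i (Poly_Mapping.single k c) * g + Poly_Mapping.single k c * tderiv i g"
  proof (induct g rule: laurent_induct)
    case (add l d g)
    have "tderiv i (Poly_Mapping.single k c * Poly_Mapping.single l d)
      = tderiv i (Poly_Mapping.single k c) * Poly_Mapping.single l d
        + Poly_Mapping.single k c * tderiv i (Poly_Mapping.single l d)"
      by (simp add: mult_single tderiv_single single_add[symmetric] algebra_simps)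
    with add show ?case by (simp add: distrib_left tderiv_add algebra_simps)
  qed (simp add: clinear_0[OF clinear_tderiv])
  with add show ?case by (simp add: distrib_right tderiv_add algebra_simps)
qed (simp add: clinear_0[OF clinear_tderiv])

lemma tderiv_commute: "tderiv i (tderiv j f) = tderiv j (tderiv i f)"
  by (rule poly_mapping_eqI) (simp add: tderiv.rep_eq)

lemma clinear_vf_apply: "clinear (vf_apply X)"
  by (simp add: clinear_iff vf_apply_def tderiv_add tderiv_scaleC distrib_left sum.distrib
      cvec.scale_sum_right mult.commute[of "X $ _"] scaleC_mult_laurent)

lemma vf_apply_left:
  "vf_apply (X + Y) f = vf_apply X f + vf_apply Y f"
  "vf_apply (c *\<^sub>C X) f = c *\<^sub>C vf_apply X f"
  by (simp_all add: vf_apply_def distrib_right sum.distrib scaleC_mult_laurent cvec.scale_sum_right)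

lemmas vf_apply_right = clinear_vf_apply[unfolded clinear_iff, THEN conjunct1, rule_format]
  clinear_vf_apply[unfolded clinear_iff, THEN conjunct2, rule_format]
  clinear_diff[OF clinear_vf_apply] clinear_0[OF clinear_vf_apply]

lemma vf_bracket_nth [simp]: "vf_bracket X Y $ j = vf_apply X (Y $ j) - vf_apply Y (X $ j)"
  by (simp add: vf_bracket_def)

lemma vf_D_nth [simp]: "vf_D u r $ i = Poly_Mapping.single r (u $ i)"
  by (simp add: vf_D_def)

lemma vf_apply_bracket:
  "vf_apply (vf_bracket X Y) f = vf_apply X (vf_apply Y f) - vf_apply Y (vf_apply X f)"
proof -
  have der: "vf_apply Z (vf_apply W f) = (\<Sum>i\<in>UNIV. vf_apply Z (W $ i) * tderiv i f)
      + (\<Sum>i\<in>UNIV. \<Sum>k\<in>UNIV. W $ i * (Z $ k * tderiv k (tderiv i f)))" for Z W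
  proof -
    have "vf_apply Z (g * h) = vf_apply Z g * h + g * vf_apply Z h" for g h
      by (simp add: vf_apply_def tderiv_mult distrib_left sum.distrib sum_distrib_left
          sum_distrib_right mult_ac)
    then show ?thesis
      by (simp add: vf_apply_def[of W] clinear_sum[OF clinear_vf_apply] sum.distrib)
        (simp add: vf_apply_def sum_distrib_left)
  qed
  have "(\<Sum>i\<in>UNIV. \<Sum>k\<in>UNIV. Y $ i * (X $ k * tderiv k (tderiv i f)))
      = (\<Sum>i\<in>UNIV. \<Sum>k\<in>UNIV. X $ i * (Y $ k * tderiv k (tderiv i f)))"
    by (subst sum.swap) (simp add: tderiv_commute mult_ac)
  then show ?thesis
    by (simp add: der vf_apply_def[of "vf_bracket X Y"] left_diff_distrib sum_subtractf)
qed

lemma vf_apply_D: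
  "vf_apply (vf_D u r) (Poly_Mapping.single s c) = Poly_Mapping.single (r + s) (pairing u s * c)"
  by (rule poly_mapping_eqI)
    (simp add: vf_apply_def tderiv_single mult_single pairing_def sum_distrib_right
        mult.assoc lookup_sum lookup_single when_def)

lemma vf_bracket_D:
  "vf_bracket (vf_D u r) (vf_D v s) = vf_D (pairing u s *s v - pairing v r *s u) (r + s)"
  by (simp add: vec_eq_iff vf_apply_D single_diff add.commute[of s r])

lemma vf_bracket_linear:
  "vf_bracket (X + X') Y = vf_bracket X Y + vf_bracket X' Y"
  "vf_bracket X (Y + Y') = vf_bracket X Y + vf_bracket X Y'"
  "vf_bracket (c *\<^sub>C X) Y = c *\<^sub>C vf_bracket X Y"
  "vf_bracket X (c *\<^sub>C Y) = c *\<^sub>C vf_bracket X Y"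
  by (simp_all add: vec_eq_iff vf_apply_left vf_apply_right cvec.scale_right_diff_distrib)

lemma vf_bracket_self: "vf_bracket X X = 0"
  by (simp add: vec_eq_iff)

lemma vf_bracket_zero: "vf_bracket X 0 = 0"
  using vf_bracket_linear(4)[of X 0 0] by simp

lemma vf_bracket_jacobi:
  "vf_bracket X (vf_bracket Y Z) + vf_bracket Y (vf_bracket Z X) + vf_bracket Z (vf_bracket X Y) = 0"
  by (simp add: vec_eq_iff vf_apply_right vf_apply_bracket)


section \<open>The Hamiltonian Lie algebra\<close>

text \<open>\<open>N = 2m\<close> is realised as the cardinality of \<open>'m + 'm\<close>; coordinate \<open>Inl i\<close> stands for \<open>i\<close>
  and \<open>Inr i\<close> for \<open>m + i\<close>, where \<open>m = CARD('m)\<close>.\<close>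

definition rbar :: "int ^ ('m + 'm) \<Rightarrow> int ^ ('m + 'm::finite)"
  where "rbar r = (\<chi> k. case k of Inl i \<Rightarrow> r $ Inr i | Inr i \<Rightarrow> - r $ Inl i)"

abbreviation cvec_of_int :: "int ^ 'n \<Rightarrow> complex ^ 'n"
  where "cvec_of_int r \<equiv> (\<chi> i. of_int (r $ i))"

definition ham :: "('m::finite + 'm) vector_field set"
  where "ham = cvec.span (range (\<lambda>r. vf_D (cvec_of_int (rbar r)) r))"

definition vf_d :: "'n \<Rightarrow> 'n::finite vector_field"
  where "vf_d i = vf_D (axis i 1) 0"

definition vf_h :: "'n::finite vector_field set"
  where "vf_h = cvec.span (range vf_d)"

text \<open>The semidirect product is internal to the Lie algebra of vector fields: \<open>ham\<close> meets \<open>vf_h\<close>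
  trivially and is stable under it.\<close>

definition ham_tilde :: "('m::finite + 'm) vector_field set"
  where "ham_tilde = {X + Y | X Y. X \<in> ham \<and> Y \<in> vf_h}"

lemma pairing_cvec_rbar: "pairing (cvec_of_int (rbar s)) r = - pairing (cvec_of_int (rbar r)) s"
proof -
  have "sum g (UNIV :: ('a + 'a) set) = (\<Sum>i\<in>UNIV. g (Inl i)) + (\<Sum>i\<in>UNIV. g (Inr i))"
    for g :: "'a + 'a \<Rightarrow> complex"
    unfolding UNIV_Plus_UNIV[symmetric] by (simp add: sum.Plus comp_def del: UNIV_Plus_UNIV)
  then show ?thesis
    by (simp add: pairing_def rbar_def sum_negf mult.commute)
qed

lemma scaleC_single: "c *\<^sub>C Poly_Mapping.single k d = Poly_Mapping.single k (c * d)"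
  by (rule poly_mapping_eqI) (simp add: lookup_single when_def scaleC_complex_def)

lemma vf_D_linear:
  "vf_D (u + v) r = vf_D u r + vf_D v r" "vf_D (c *s u) r = c *\<^sub>C vf_D u r"
  by (simp_all add: vec_eq_iff single_add scaleC_single)

lemma ham_tilde_eq_span:
  "ham_tilde = cvec.span (range (\<lambda>r. vf_D (cvec_of_int (rbar r)) r) \<union> range vf_d)"
  unfolding ham_tilde_def ham_def vf_h_def by (auto simp: cvec.span_Un)

lemma subspace_ham_tilde: "cvec.subspace ham_tilde"
  by (simp add: ham_tilde_eq_span cvec.subspace_span)

lemma vf_bracket_ham_tilde:
  fixes X Y :: "('m::finite + 'm) vector_field"
  assumes "X \<in> ham_tilde" "Y \<in> ham_tilde"
  shows "vf_bracket X Y \<in> ham_tilde"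
proof -
  let ?H = "\<lambda>r :: int ^ ('m + 'm). vf_D (cvec_of_int (rbar r)) r"
  let ?G = "range ?H \<union> range (vf_d :: 'm + 'm \<Rightarrow> _)"
  have H: "c *\<^sub>C ?H r \<in> ham_tilde" for c r
    unfolding ham_tilde_eq_span by (intro cvec.span_scale cvec.span_base) auto
  have HH: "vf_bracket (?H r) (?H s) \<in> ham_tilde" for r s
  proof -
    have "cvec_of_int (rbar (r + s)) = cvec_of_int (rbar r) + cvec_of_int (rbar s)"
      by (auto simp: vec_eq_iff rbar_def split: sum.split)
    then have "vf_bracket (?H r) (?H s) = pairing (cvec_of_int (rbar r)) s *\<^sub>C ?H (r + s)"
      by (simp add: vf_bracket_D pairing_cvec_rbar[of s r] vf_D_linear[symmetric]
          vec.scale_right_distrib add.commute)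
    then show ?thesis using H by simp
  qed
  have p0: "pairing u 0 = 0" for u :: "complex ^ ('m + 'm)" by (simp add: pairing_def)
  have dH: "vf_bracket (vf_d i) (?H r) \<in> ham_tilde" for i r
    using H by (simp add: vf_d_def vf_bracket_D p0 vf_D_linear)
  have Hd: "vf_bracket (?H r) (vf_d i) \<in> ham_tilde" for i r
  proof -
    have "vf_bracket (?H r) (vf_d i) = (-1) *\<^sub>C vf_bracket (vf_d i) (?H r)"
      by (simp add: vec_eq_iff)
    then show ?thesis by (simp only: cvec.subspace_scale[OF subspace_ham_tilde dH])
  qed
  have dd: "vf_bracket (vf_d i) (vf_d j) \<in> ham_tilde" for i j :: "'m + 'm"
  proof -
    have "vf_bracket (vf_d i) (vf_d j) = 0" by (simp add: vf_d_def vf_bracket_D p0) (simp add: vec_eq_iff)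
    then show ?thesis by (simp add: cvec.subspace_0[OF subspace_ham_tilde])
  qed
  have GG: "vf_bracket x y \<in> ham_tilde" if "x \<in> ?G" "y \<in> ?G" for x y
    using that HH dH Hd dd by auto
  have sub1: "cvec.subspace {y. vf_bracket x y \<in> ham_tilde}" for x :: "('m + 'm) vector_field"
    using subspace_ham_tilde vf_bracket_linear(4)[of x 0 0]
    by (auto simp: cvec.subspace_def vf_bracket_linear)
  have sub2: "cvec.subspace {x. vf_bracket x y \<in> ham_tilde}" for y :: "('m + 'm) vector_field"
    using subspace_ham_tilde vf_bracket_linear(3)[of 0 0 y]
    by (auto simp: cvec.subspace_def vf_bracket_linear)
  have "vf_bracket x Y \<in> ham_tilde" if "x \<in> ?G" for x
    using cvec.span_minimal[OF _ sub1, of ?G x] GG[OF that] assms(2)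
    unfolding ham_tilde_eq_span by blast
  then show ?thesis
    using cvec.span_minimal[OF _ sub2, of ?G Y] assms(1)
    unfolding ham_tilde_eq_span by blast
qed

typedef (overloaded) 'm ham_laurent =
  "(ham_tilde :: ('m::finite + 'm) vector_field set) \<times> (UNIV :: ('m + 'm) laurent set)"
  by (rule exI[of _ "(0, 0)"]) (simp add: cvec.subspace_0[OF subspace_ham_tilde])

setup_lifting type_definition_ham_laurent

instantiation ham_laurent :: (finite) complex_lie_algebra
begin

lift_definition zero_ham_laurent :: "'a ham_laurent" is "(0, 0)"
  by (simp add: cvec.subspace_0[OF subspace_ham_tilde])

lift_definition plus_ham_laurent :: "'a ham_laurent \<Rightarrow> 'a ham_laurent \<Rightarrow> 'a ham_laurent"
  is "\<lambda>(X, f) (Y, g). (X + Y, f + g)"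
  by (auto simp: cvec.subspace_add[OF subspace_ham_tilde])

lift_definition uminus_ham_laurent :: "'a ham_laurent \<Rightarrow> 'a ham_laurent"
  is "\<lambda>(X, f). (- X, - f)"
  by (auto simp: cvec.subspace_neg[OF subspace_ham_tilde])

lift_definition minus_ham_laurent :: "'a ham_laurent \<Rightarrow> 'a ham_laurent \<Rightarrow> 'a ham_laurent"
  is "\<lambda>(X, f) (Y, g). (X - Y, f - g)"
  by (auto simp: cvec.subspace_diff[OF subspace_ham_tilde])

lift_definition scaleC_ham_laurent :: "complex \<Rightarrow> 'a ham_laurent \<Rightarrow> 'a ham_laurent"
  is "\<lambda>c (X, f). (c *\<^sub>C X, c *\<^sub>C f)"
  by (auto simp: cvec.subspace_scale[OF subspace_ham_tilde])

lift_definition lie_bracket_ham_laurent :: "'a ham_laurent \<Rightarrow> 'a ham_laurent \<Rightarrow> 'a ham_laurent"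
  is "\<lambda>(X, f) (Y, g). (vf_bracket X Y, vf_apply X g - vf_apply Y f)"
  by (auto simp: vf_bracket_ham_tilde)

instance
proof
  fix x y z :: "'a ham_laurent" and a b :: complex
  show "x + y + z = x + (y + z)" by transfer (auto simp: add.assoc)
  show "x + y = y + x" by transfer (auto simp: add.commute)
  show "0 + x = x" by transfer auto
  show "- x + x = 0" by transfer auto
  show "x - y = x + - y" by transfer auto
  show "a *\<^sub>C (x + y) = a *\<^sub>C x + a *\<^sub>C y" by transfer (auto simp: scaleC_add_right)
  show "(a + b) *\<^sub>C x = a *\<^sub>C x + b *\<^sub>C x" by transfer (auto simp: scaleC_add_left)
  show "a *\<^sub>C (b *\<^sub>C x) = (a * b) *\<^sub>C x" by transfer (auto simp: scaleC_scaleC)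
  show "1 *\<^sub>C x = x" by transfer (auto simp: scaleC_one)
  show "lie_bracket (x + y) z = lie_bracket x z + lie_bracket y z"
    by transfer (auto simp: vf_bracket_linear vf_apply_left vf_apply_right)
  show "lie_bracket x (y + z) = lie_bracket x y + lie_bracket x z"
    by transfer (auto simp: vf_bracket_linear vf_apply_left vf_apply_right)
  show "lie_bracket (a *\<^sub>C x) y = a *\<^sub>C lie_bracket x y"
    by transfer (auto simp: vf_bracket_linear vf_apply_left vf_apply_right
        cvec.scale_right_diff_distrib)
  show "lie_bracket x (a *\<^sub>C y) = a *\<^sub>C lie_bracket x y"
    by transfer (auto simp: vf_bracket_linear vf_apply_left vf_apply_right
        cvec.scale_right_diff_distrib)
  show "lie_bracket x x = 0"
    by transfer (auto simp: vf_bracket_self)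
  show "lie_bracket x (lie_bracket y z) + lie_bracket y (lie_bracket z x)
      + lie_bracket z (lie_bracket x y) = 0"
    by transfer (auto simp: vf_bracket_jacobi vf_apply_right vf_apply_bracket)
qed

end

lift_definition hamD :: "int ^ ('m + 'm) \<Rightarrow> 'm::finite ham_laurent"
  is "\<lambda>r. (vf_D (cvec_of_int (rbar r)) r, 0)"
  by (auto simp: ham_tilde_eq_span intro: cvec.span_base)

lift_definition hamd :: "'m + 'm \<Rightarrow> 'm::finite ham_laurent"
  is "\<lambda>i. (vf_d i, 0)"
  by (auto simp: ham_tilde_eq_span intro: cvec.span_base)

lift_definition tmon :: "int ^ ('m + 'm) \<Rightarrow> 'm::finite ham_laurent"
  is "\<lambda>s. (0, Poly_Mapping.single s 1)"
  by (simp add: cvec.subspace_0[OF subspace_ham_tilde])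

definition cartan :: "'m::finite ham_laurent set"
  where "cartan = cvec.span (range hamd)"

lemma lie_bracket_hamD_hamD:
  "lie_bracket (hamD r) (hamD s) = pairing (cvec_of_int (rbar r)) s *\<^sub>C hamD (r + s)"
proof -
  have *: "cvec_of_int (rbar (r + s)) = cvec_of_int (rbar r) + cvec_of_int (rbar s)"
    by (auto simp: vec_eq_iff rbar_def split: sum.split)
  show ?thesis
    by (transfer fixing: r s)
      (simp add: * vf_bracket_D pairing_cvec_rbar[of s r] vf_D_linear[symmetric]
        vec.scale_right_distrib add.commute vf_apply_right)
qed

lemma lie_bracket_hamD_tmon:
  "lie_bracket (hamD r) (tmon s) = pairing (cvec_of_int (rbar r)) s *\<^sub>C tmon (r + s)"
  by transfer (simp add: vf_apply_D scaleC_single vf_apply_right vf_bracket_zero)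

lemma lie_bracket_tmon_tmon: "lie_bracket (tmon r) (tmon s) = 0"
  by transfer (simp add: vf_bracket_zero vf_apply_def)

lemma lie_bracket_hamd_tmon: "lie_bracket (hamd i) (tmon s) = of_int (s $ i) *\<^sub>C tmon s"
  by transfer (simp add: vf_d_def vf_apply_D scaleC_single vf_apply_right vf_bracket_zero
      pairing_def axis_def if_distrib[of "\<lambda>y. y * _"] cong: if_cong)


section \<open>Modules\<close>

locale lie_module =
  fixes \<rho> :: "'l::complex_lie_algebra \<Rightarrow> 'v::complex_vector \<Rightarrow> 'v"
  assumes clinear_left: "clinear (\<lambda>x. \<rho> x v)"
    and clinear_right: "clinear (\<rho> x)"
    and bracket: "\<rho> (lie_bracket x y) v = \<rho> x (\<rho> y v) - \<rho> y (\<rho> x v)"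

definition irreducible_lie_module ::
    "('l::complex_lie_algebra \<Rightarrow> 'v::complex_vector \<Rightarrow> 'v) \<Rightarrow> bool"
  where "irreducible_lie_module \<rho> \<longleftrightarrow> lie_module \<rho> \<and> (UNIV :: 'v set) \<noteq> {0} \<and>
    (\<forall>W. cvec.subspace W \<and> (\<forall>x. \<forall>w\<in>W. \<rho> x w \<in> W) \<longrightarrow> W = {0} \<or> W = UNIV)"

text \<open>Functionals on a subspace \<open>H\<close> are made canonical by taking the value \<^const>\<open>undefined\<close>
  outside \<open>H\<close>.\<close>

definition dual_space :: "'a::complex_vector set \<Rightarrow> ('a \<Rightarrow> complex) set"
  where "dual_space H = {l \<in> extensional H.
    (\<forall>x\<in>H. \<forall>y\<in>H. l (x + y) = l x + l y) \<and> (\<forall>c. \<forall>x\<in>H. l (c *\<^sub>C x) = c * l x)}"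

definition is_direct_sum :: "'i set \<Rightarrow> ('i \<Rightarrow> 'v::complex_vector set) \<Rightarrow> bool"
  where "is_direct_sum I W \<longleftrightarrow> (\<forall>v. \<exists>!f. (\<forall>i\<in>I. f i \<in> W i) \<and> (\<forall>i. i \<notin> I \<longrightarrow> f i = 0) \<and>
    finite {i. f i \<noteq> 0} \<and> v = (\<Sum>i | f i \<noteq> 0. f i))"

definition weight_space ::
    "(('m::finite ham_laurent, 'b::complex_comm_algebra) tensor \<Rightarrow> 'v::complex_vector \<Rightarrow> 'v) \<Rightarrow>
     ('m ham_laurent \<Rightarrow> complex) \<Rightarrow> 'v set"
  where "weight_space \<rho> \<mu> = {v. \<forall>h\<in>cartan. \<rho> (h \<otimes>\<^sub>C 1) v = \<mu> h *\<^sub>C v}"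

text \<open>\<^const>\<open>cvec.dim\<close> is \<open>0\<close> on infinite-dimensional spaces, hence the separate requirement of a
  finite spanning set.\<close>

definition uniformly_bounded_HC_module ::
    "(('m::finite ham_laurent, 'b::complex_comm_algebra) tensor \<Rightarrow> 'v::complex_vector \<Rightarrow> 'v) \<Rightarrow> bool"
  where "uniformly_bounded_HC_module \<rho> \<longleftrightarrow> lie_module \<rho> \<and>
    is_direct_sum (dual_space cartan) (weight_space \<rho>) \<and>
    (\<exists>M::nat. M > 0 \<and> (\<forall>\<mu>\<in>dual_space cartan.
      (\<exists>S. finite S \<and> cvec.span S = weight_space \<rho> \<mu>) \<and> cvec.dim (weight_space \<rho> \<mu>) \<le> M))"

end

theory Submission
  imports Defs "HOL-Computational_Algebra.Polynomial"
begin

text \<open>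
  Write \<open>T s\<close>, \<open>X s b\<close> and \<open>H i b\<close> for the operators by which \<open>t\<^sup>s\<close>, \<open>D(s\<bar>, s) b\<close> and \<open>d\<^sub>i b\<close> act on
  \<open>V\<close>, and \<open>(q\<bar>, s)\<close> for the symplectic form. Replacing \<open>b\<close> by \<open>b - \<psi> b\<close>, it suffices to show that
  \<open>X s b = 0\<close> whenever \<open>\<psi> b = 0\<close>. For such \<open>b\<close> the operators \<open>X s b\<close> and \<open>H i b\<close> commute with every
  \<open>T r\<close>.

  The monomials act injectively (\<open>T_injective\<close>). Let \<open>P\<close> be the commutative algebra generated by the
  \<open>T s\<close>; bracketing with the Lie algebra maps \<open>P\<close> to itself, so the generalised kernel of an \<open>f\<close> in
  \<open>P\<close> is a submodule and \<open>f\<close> is injective or locally nilpotent. For \<open>f\<close> of weight \<open>0\<close> the bound on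
  the weight spaces makes local nilpotency uniform. The nilpotent elements of \<open>P\<close> form a radical
  ideal \<open>N\<close> stable under all \<open>[X q c, \<cdot>]\<close>. If \<open>T r\<close> has a kernel for some nonzero \<open>r\<close>, then
  \<open>T r T (- r)\<close> lies in \<open>N\<close>, and repeated bracketing puts every \<open>T a\<close> with \<open>a \<noteq> 0\<close> into \<open>N\<close>
  (\<open>T_T_neg_nilpotent\<close>). Differentiating \<open>T r ^ k = 0\<close> then shows that products of \<open>k\<close> monomials
  from the half space \<open>(\<cdot>\<bar>, r) > 0\<close> vanish (\<open>half_space_products\<close>). Finitely many half spaces cover
  all nonzero exponents, so the \<open>T a\<close> with \<open>a \<noteq> 0\<close> have a common kernel, which is a submodule; hence
  they all vanish, a contradiction.

  Each \<open>X s b\<close> with \<open>\<psi> b = 0\<close> is nilpotent on every weight space (\<open>X_locally_nilpotent\<close>). Indeed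
  \<open>[H i b, T (- s) X s 1] = s\<^sub>i T (- s) X s b\<close>, and this commutator commutes with
  \<open>T (- s) X s 1\<close>, so it is nilpotent by Jacobson's lemma (\<open>nilpotent_commutator\<close>). Brackets among
  the \<open>X s b\<close> and \<open>T r\<close> alone would not suffice here, since they are compatible with \<open>X s b\<close>, for
  \<open>s \<noteq> 0\<close>, acting as \<open>\<delta> b\<close> times \<open>T s\<close> for a derivation \<open>\<delta>\<close> of \<open>B\<close> at \<open>\<psi>\<close>; the operators \<open>H i b\<close> exclude this.

  The operators \<open>f X s b\<close> with \<open>f\<close> in \<open>P\<close> of weight \<open>- s\<close> and \<open>\<psi> b = 0\<close> act on each weight space,
  are nilpotent there, and form a set closed under brackets. By Engel's theorem in Jacobson's form
  (\<open>engel_bracket_closed\<close>) they kill a common nonzero vector. Since \<open>T (- s)\<close> is injective, this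
  vector is killed by all \<open>X s b\<close> with \<open>\<psi> b = 0\<close>. The vectors killed by all these form a submodule, so they are all of \<open>V\<close>.
\<close>

section \<open>The ring of linear endomorphisms\<close>

text \<open>The linear endomorphisms of \<open>V\<close> are made into a type in order to have the ring operations and
  powers of operators. The unit is not required to differ from \<open>0\<close>, since \<open>V\<close> may be zero.\<close>

typedef (overloaded) 'v endo = "{f :: 'v::complex_vector \<Rightarrow> 'v. clinear f}"
  morphisms app Endo
  by (rule exI[of _ id]) (simp add: clinear_iff)

setup_lifting type_definition_endo

instantiation endo :: (complex_vector) "{ring, monoid_mult, complex_vector}"
begin

lift_definition zero_endo :: "'a endo" is "\<lambda>v. 0" by (simp add: clinear_iff)
lift_definition one_endo :: "'a endo" is "\<lambda>v. v" by (simp add: clinear_iff)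
lift_definition plus_endo :: "'a endo \<Rightarrow> 'a endo \<Rightarrow> 'a endo" is "\<lambda>f g v. f v + g v"
  by (simp add: clinear_iff scaleC_add_right)
lift_definition minus_endo :: "'a endo \<Rightarrow> 'a endo \<Rightarrow> 'a endo" is "\<lambda>f g v. f v - g v"
  by (simp add: clinear_iff cvec.scale_right_diff_distrib)
lift_definition uminus_endo :: "'a endo \<Rightarrow> 'a endo" is "\<lambda>f v. - f v"
  by (simp add: clinear_iff)
lift_definition times_endo :: "'a endo \<Rightarrow> 'a endo \<Rightarrow> 'a endo" is "\<lambda>f g v. f (g v)"
  by (simp add: clinear_iff)
lift_definition scaleC_endo :: "complex \<Rightarrow> 'a endo \<Rightarrow> 'a endo" is "\<lambda>c f v. c *\<^sub>C f v"
  by (simp add: clinear_iff scaleC_add_right scaleC_scaleC mult.commute)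

instance
  by standard (transfer; simp add: clinear_iff fun_eq_iff scaleC_add_right scaleC_add_left
      scaleC_scaleC scaleC_one add.assoc; fail | transfer; simp add: fun_eq_iff add.commute)+

end

lemma app_simps [simp]:
  "app 0 v = 0" "app 1 v = v" "app (f + g) v = app f v + app g v"
  "app (f - g) v = app f v - app g v" "app (- f) v = - app f v"
  "app (f * g) v = app f (app g v)" "app (c *\<^sub>C f) v = c *\<^sub>C app f v"
  by (transfer; simp)+

lemma app_linear [simp]:
  "app f (u + v) = app f u + app f v" "app f (c *\<^sub>C v) = c *\<^sub>C app f v"
  "app f 0 = 0" "app f (u - v) = app f u - app f v" "app f (- v) = - app f v"
proof -
  have l: "clinear (app f)" using app[of f] by simp
  then show "app f (u + v) = app f u + app f v" "app f (c *\<^sub>C v) = c *\<^sub>C app f v"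
    "app f 0 = 0" "app f (u - v) = app f u - app f v"
    by (simp_all only: clinear_0 clinear_diff) (simp_all only: clinear_iff)
  have "app f (- v) = app f (0 - v)" by simp
  also have "\<dots> = - app f v" using l by (simp only: clinear_0 clinear_diff) simp
  finally show "app f (- v) = - app f v" .
qed

lemma endo_eqI: "(\<And>v. app f v = app g v) \<Longrightarrow> f = g"
  by transfer auto

lemma endo_scaleC [simp]:
  fixes f g :: "'v::complex_vector endo"
  shows "(c *\<^sub>C f) * g = c *\<^sub>C (f * g)" "f * (c *\<^sub>C g) = c *\<^sub>C (f * g)"
  by (rule endo_eqI; simp)+

lemma subspace_app_kernel: "cvec.subspace {v. app f v = 0}"
  by (simp add: cvec.subspace_def)

lemma app_power_0_mono: "app (f ^ k) v = 0 \<Longrightarrow> k \<le> l \<Longrightarrow> app (f ^ l) v = 0"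
proof -
  assume "app (f ^ k) v = 0" "k \<le> l"
  then have "app (f ^ ((l - k) + k)) v = 0" by (simp only: power_add app_simps app_linear)
  with \<open>k \<le> l\<close> show ?thesis by simp
qed

section \<open>Spaces of bounded dimension\<close>

text \<open>\<open>dim_at_most n U\<close>: the set \<open>U\<close> is contained in a subspace of dimension at most \<open>n\<close>.\<close>

definition dim_at_most :: "nat \<Rightarrow> 'v::complex_vector set \<Rightarrow> bool"
  where "dim_at_most n U \<longleftrightarrow> (\<exists>S. finite S \<and> card S \<le> n \<and> U \<subseteq> cvec.span S)"

text \<open>Among \<open>n + 1\<close> vectors some vector depends linearly on the preceding ones.\<close>

lemma dim_at_most_dependent:
  assumes "dim_at_most n U" "\<And>j. j \<le> n \<Longrightarrow> u j \<in> U"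
  obtains j where "j \<le> n" "u j \<in> cvec.span (u ` {..<j})"
proof (rule ccontr)
  assume "\<not> thesis"
  with that have neg: "u j \<notin> cvec.span (u ` {..<j})" if "j \<le> n" for j using \<open>j \<le> n\<close> by blast
  have ind: "cvec.independent (u ` {..<m}) \<and> card (u ` {..<m}) = m" if "m \<le> Suc n" for m
    using that
  proof (induction m)
    case 0
    then show ?case by (simp add: cvec.independent_empty)
  next
    case (Suc m)
    then have i: "cvec.independent (u ` {..<m})" "card (u ` {..<m}) = m" by auto
    have n: "u m \<notin> cvec.span (u ` {..<m})" by (rule neg) (use Suc.prems in simp)
    then have "u m \<notin> u ` {..<m}" using cvec.span_base[of "u m" "u ` {..<m}"] by (rule contrapos_nn)
    with i n show ?case
      unfolding lessThan_Suc image_insert by (simp add: cvec.independent_insert)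
  qed
  obtain S where S: "finite S" "card S \<le> n" "U \<subseteq> cvec.span S"
    using assms(1) unfolding dim_at_most_def by blast
  have "u ` {..<Suc n} \<subseteq> cvec.span S" using S(3) assms(2) by (auto simp: less_Suc_eq_le)
  then have "card (u ` {..<Suc n}) \<le> card S"
    using cvec.independent_span_bound[OF S(1)] ind[of "Suc n"] by blast
  then show False using ind[of "Suc n"] S(2) by simp
qed

text \<open>If some power of \<open>x\<close> kills \<open>u\<close>, then the \<open>n\<close>-th power does, where \<open>n\<close> bounds the dimension: the
  vectors \<open>x ^ (n - j) u\<close> would otherwise be \<open>n + 1\<close> independent ones.\<close>

lemma nilpotent_on_bound:
  assumes U: "dim_at_most n U" and pres: "\<And>u. u \<in> U \<Longrightarrow> app x u \<in> U"
    and u: "u \<in> U" and nil: "app (x ^ k) u = 0"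
  shows "app (x ^ n) u = 0"
proof (rule ccontr)
  assume ne: "app (x ^ n) u \<noteq> 0"
  define l where "l = (LEAST l. app (x ^ l) u = 0)"
  have l0: "app (x ^ l) u = 0" unfolding l_def by (rule LeastI[of _ k]) (rule nil)
  have l1: "app (x ^ m) u \<noteq> 0" if "m < l" for m using that not_less_Least unfolding l_def by blast
  have nl: "n < l" using ne l0 app_power_0_mono by (metis not_le)
  have pow: "app (x ^ i) u \<in> U" for i by (induction i) (simp_all add: u pres)
  obtain j where j: "j \<le> n" "app (x ^ (n - j)) u \<in> cvec.span ((\<lambda>j. app (x ^ (n - j)) u) ` {..<j})"
    by (rule dim_at_most_dependent[OF U, of "\<lambda>j. app (x ^ (n - j)) u"]) (auto simp: pow)
  let ?e = "l - 1 - (n - j)"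
  have "(\<lambda>j. app (x ^ (n - j)) u) ` {..<j} \<subseteq> {w. app (x ^ ?e) w = 0}"
  proof (clarsimp)
    fix i assume i: "i < j"
    have "app (x ^ (?e + (n - i))) u = 0"
      by (rule app_power_0_mono[OF l0]) (use i j nl in auto)
    then show "app (x ^ (l - Suc (n - j))) (app (x ^ (n - i)) u) = 0" by (simp add: power_add)
  qed
  with cvec.span_minimal[OF this subspace_app_kernel] j(2)
  have "app (x ^ ?e) (app (x ^ (n - j)) u) = 0" by blast
  then have "app (x ^ (?e + (n - j))) u = 0" by (simp add: power_add)
  moreover have "?e + (n - j) = l - 1" using nl by simp
  ultimately show False using l1[of "l - 1"] nl by simp
qed

section \<open>Engel's theorem for bracket-closed sets of nilpotent operators\<close>

text \<open>\<open>kills U L S\<close>: every product of \<open>L\<close> operators from \<open>S\<close> vanishes on \<open>U\<close>.\<close>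

definition kills :: "'v::complex_vector set \<Rightarrow> nat \<Rightarrow> 'v endo set \<Rightarrow> bool"
  where "kills U L S \<longleftrightarrow>
    (\<forall>xs. set xs \<subseteq> S \<and> length xs = L \<longrightarrow> (\<forall>u\<in>U. app (prod_list xs) u = 0))"

lemma app_prod_list_append: "app (prod_list (xs @ ys)) u = app (prod_list xs) (app (prod_list ys) u)"
  by (induction xs) auto

lemma app_prod_list_in:
  assumes "\<And>x u. x \<in> S \<Longrightarrow> u \<in> U \<Longrightarrow> app x u \<in> U" "set xs \<subseteq> S" "u \<in> U"
  shows "app (prod_list xs) u \<in> U"
  using assms(2) by (induction xs) (auto simp: assms)

lemma kills_length_ge:
  assumes "kills U L S" "set xs \<subseteq> S" "L \<le> length xs" "u \<in> U"
  shows "app (prod_list xs) u = 0"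
proof -
  let ?k = "length xs - L"
  have "app (prod_list (drop ?k xs)) u = 0"
    using assms set_drop_subset[of ?k xs] unfolding kills_def by auto
  then have "app (prod_list (take ?k xs @ drop ?k xs)) u = 0"
    by (simp only: app_prod_list_append app_linear)
  then show ?thesis by simp
qed

lemma longest_nonvanishing_product:
  assumes kills: "kills U L S" and u: "u \<in> U" "u \<noteq> 0"
  obtains ys where "set ys \<subseteq> S" "app (prod_list ys) u \<noteq> 0"
    "\<And>zs. set zs \<subseteq> S \<Longrightarrow> length ys < length zs \<Longrightarrow> app (prod_list zs) u = 0"
proof -
  let ?P = "\<lambda>l. \<exists>ys. set ys \<subseteq> S \<and> length ys = l \<and> app (prod_list ys) u \<noteq> 0"
  have P0: "?P 0" using u by (intro exI[of _ "[]"]) simp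
  have bd: "\<And>l. ?P l \<Longrightarrow> l \<le> L" using kills_length_ge[OF kills _ _ u(1)] by (metis nat_le_linear)
  have "?P (Greatest ?P)" by (rule GreatestI_nat[where P = ?P, OF P0 bd])
  then obtain ys where ys: "set ys \<subseteq> S" "length ys = Greatest ?P" "app (prod_list ys) u \<noteq> 0" by blast
  have "app (prod_list zs) u = 0" if "set zs \<subseteq> S" "length ys < length zs" for zs
  proof (rule ccontr)
    assume "app (prod_list zs) u \<noteq> 0"
    then have "?P (length zs)" using that by blast
    then have "length zs \<le> Greatest ?P" by (rule Greatest_le_nat[where P = ?P]) (rule bd)
    then show False using that ys(2) by simp
  qed
  with ys that show ?thesis by blast
qed

text \<open>The nilpotency index can always be taken to be the dimension. This uniform bound is what makes
  nilpotency pass to unions of chains below.\<close>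

lemma kills_dim:
  assumes U: "dim_at_most n U" and pres: "\<And>x u. x \<in> S \<Longrightarrow> u \<in> U \<Longrightarrow> app x u \<in> U"
    and kills: "kills U L S"
  shows "kills U n S"
  unfolding kills_def
proof (intro allI impI ballI, rule ccontr)
  fix xs u assume xs: "set xs \<subseteq> S \<and> length xs = n" and u: "u \<in> U"
    and ne: "app (prod_list xs) u \<noteq> 0"
  define v where "v j = app (prod_list (drop j xs)) u" for j
  have sub: "set (drop j xs) \<subseteq> S" "set (take j xs) \<subseteq> S" for j
    using xs set_drop_subset[of j xs] set_take_subset[of j xs] by auto
  have vU: "v j \<in> U" for j unfolding v_def by (rule app_prod_list_in[OF pres sub(1) u])
  obtain j where j: "j \<le> n" "v j \<in> cvec.span (v ` {..<j})"
    by (rule dim_at_most_dependent[OF U, of v]) (auto simp: vU)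
  have split: "v i = app (prod_list (take (k - i) (drop i xs))) (v k)" if "i \<le> k" for i k
    using that unfolding v_def
    by (metis app_prod_list_append append_take_drop_id drop_drop le_add_diff_inverse2)
  have "v 0 \<noteq> 0" using ne by (simp add: v_def)
  then have vj: "v j \<noteq> 0" using split[of 0 j] by auto
  obtain ys where ys: "set ys \<subseteq> S" "app (prod_list ys) (v j) \<noteq> 0"
    "\<And>zs. set zs \<subseteq> S \<Longrightarrow> length ys < length zs \<Longrightarrow> app (prod_list zs) (v j) = 0"
    using longest_nonvanishing_product[OF kills vU vj] by blast
  have "v ` {..<j} \<subseteq> {w. app (prod_list ys) w = 0}"
  proof clarsimp
    fix i assume i: "i < j"
    have "app (prod_list (ys @ take (j - i) (drop i xs))) (v j) = 0"
      by (rule ys(3)) (use ys(1) sub i j xs in \<open>auto dest!: in_set_takeD in_set_dropD\<close>)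
    then show "app (prod_list ys) (v i) = 0"
      using split[of i j] i by (simp add: app_prod_list_append)
  qed
  from cvec.span_minimal[OF this subspace_app_kernel] j(2) ys(2) show False by blast
qed

text \<open>Adjoining to \<open>S\<close> a nilpotent operator that normalises it.\<close>

lemma kills_insert:
  assumes U: "dim_at_most n U"
    and pres: "\<And>x u. x \<in> insert w S \<Longrightarrow> u \<in> U \<Longrightarrow> app x u \<in> U"
    and kills: "kills U n S" and norm: "\<And>s. s \<in> S \<Longrightarrow> s * w - w * s \<in> S"
    and nil: "\<And>u. u \<in> U \<Longrightarrow> \<exists>k. app (w ^ k) u = 0"
  shows "kills U n (insert w S)"
proof (rule kills_dim[OF U pres])
  \<comment> \<open>The ascending filtration of \<open>U\<close> by the common kernels of products of \<open>i\<close> elements of \<open>S\<close>.\<close>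
  define F where "F i = {u \<in> U. \<forall>xs. set xs \<subseteq> S \<and> length xs = i \<longrightarrow> app (prod_list xs) u = 0}" for i
  have FD: "app (prod_list xs) u = 0" if "u \<in> F i" "set xs \<subseteq> S" "length xs = i" for u xs i
    using that unfolding F_def by blast
  have F0: "app x u \<in> F i" if "x \<in> S" "u \<in> F (Suc i)" for x u i
  proof -
    have "app (prod_list xs) (app x u) = 0" if "set xs \<subseteq> S" "length xs = i" for xs
    proof -
      have "app (prod_list (xs @ [x])) u = 0"
        by (rule FD[OF \<open>u \<in> F (Suc i)\<close>]) (use that \<open>x \<in> S\<close> in auto)
      then show ?thesis by (simp add: app_prod_list_append)
    qed
    with that pres show ?thesis unfolding F_def by auto
  qed
  have Fmono: "app x u \<in> F i" if "x \<in> S" "u \<in> F i" for x u i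
  proof -
    have "app (prod_list xs) (app x u) = 0" if "set xs \<subseteq> S" "length xs = i" for xs
    proof (cases xs)
      case Nil
      with that \<open>u \<in> F i\<close> have "u = 0" unfolding F_def by auto
      then show ?thesis by simp
    next
      case (Cons y ys)
      have "app (prod_list (ys @ [x])) u = 0"
        by (rule FD[OF \<open>u \<in> F i\<close>]) (use that Cons \<open>x \<in> S\<close> in auto)
      then show ?thesis by (simp add: Cons app_prod_list_append)
    qed
    with that pres show ?thesis unfolding F_def by auto
  qed
  have Fw: "app w u \<in> F i" if "u \<in> F i" for u i
  proof -
    have "app (prod_list ys) (app w (app (prod_list xs) u)) = 0"
      if "set ys \<subseteq> S" "set xs \<subseteq> S" "length ys + length xs = i" for xs ys
      using that
    proof (induction ys arbitrary: xs rule: rev_induct)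
      case Nil
      then show ?case using \<open>u \<in> F i\<close> unfolding F_def by auto
    next
      case (snoc y ys)
      let ?u = "app (prod_list xs) u"
      have 1: "app (prod_list ys) (app w (app (prod_list (y # xs)) u)) = 0"
        by (rule snoc.IH) (use snoc.prems in auto)
      have "app (prod_list (ys @ (y * w - w * y) # xs)) u = 0"
        by (rule FD[OF \<open>u \<in> F i\<close>]) (use snoc.prems norm[of y] in auto)
      with 1 show ?case by (simp add: app_prod_list_append)
    qed
    from this[of _ "[]"] that pres show ?thesis unfolding F_def by auto
  qed
  have Fx: "app x u \<in> F i" if "x \<in> insert w S" "u \<in> F i" for x u i
    using that Fmono Fw by auto
  have Fl: "app (prod_list xs) u \<in> F i" if "set xs \<subseteq> insert w S" "u \<in> F i" for xs u i
    by (rule app_prod_list_in[OF Fx that])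
  have zF: "0 \<in> F i" if "u \<in> F i" for u i
  proof -
    have "app (w ^ k) u \<in> F i" for k by (induction k) (simp_all add: that Fw)
    then show ?thesis using nil[of u] that unfolding F_def by (metis (no_types, lifting) mem_Collect_eq)
  qed
  \<comment> \<open>Among \<open>n\<close> factors either one lies in \<open>S\<close>, which lowers the filtration, or all equal \<open>w\<close>, and
    \<open>w ^ n\<close> vanishes on \<open>U\<close>.\<close>
  have step: "app (prod_list xs) u \<in> F i"
    if "set xs \<subseteq> insert w S" "length xs = n" "u \<in> F (Suc i)" for xs u i
  proof (cases "set xs \<subseteq> {w}")
    case True
    then have "xs = replicate n w" using that(2) by (metis replicate_eqI singletonD subsetD)
    moreover have "app (w ^ n) u = 0"
    proof -
      have "u \<in> U" using that(3) unfolding F_def by simp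
      with nil obtain k where "app (w ^ k) u = 0" by blast
      from nilpotent_on_bound[OF U _ \<open>u \<in> U\<close> this] pres show ?thesis by blast
    qed
    moreover have "0 \<in> F i"
    proof -
      have "0 \<in> F (Suc i)" by (rule zF[OF that(3)])
      then have "0 \<in> U" unfolding F_def by simp
      then show ?thesis unfolding F_def by simp
    qed
    ultimately show ?thesis by (simp add: prod_list_replicate)
  next
    case False
    with that(1) have "\<exists>x\<in>set xs. x \<in> S" by auto
    then obtain s ys zs where s: "xs = ys @ s # zs" "s \<in> S" by (meson split_list)
    have "app (prod_list zs) u \<in> F (Suc i)" by (rule Fl) (use that s in auto)
    then have "app s (app (prod_list zs) u) \<in> F i" by (rule F0[OF s(2)])
    then have "app (prod_list ys) (app s (app (prod_list zs) u)) \<in> F i"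
      by (rule Fl[rotated]) (use that s in auto)
    then show ?thesis by (simp add: s app_prod_list_append)
  qed
  have iter: "app (prod_list xs) u = 0"
    if "set xs \<subseteq> insert w S" "length xs = n * i" "u \<in> F i" for xs u i
    using that
  proof (induction i arbitrary: xs u)
    case 0
    then show ?case unfolding F_def by auto
  next
    case (Suc i)
    let ?ys = "take (n * i) xs" and ?zs = "drop (n * i) xs"
    have "set ?ys \<subseteq> insert w S" "set ?zs \<subseteq> insert w S"
      using Suc.prems(1) set_take_subset[of "n * i" xs] set_drop_subset[of "n * i" xs] by blast+
    moreover from this have "app (prod_list ?zs) u \<in> F i"
      by (intro step) (use Suc.prems in auto)
    ultimately have "app (prod_list ?ys) (app (prod_list ?zs) u) = 0"
      using Suc.prems by (intro Suc.IH) auto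
    then have "app (prod_list (?ys @ ?zs)) u = 0" by (simp only: app_prod_list_append)
    then show ?case by simp
  qed
  have "U \<subseteq> F n" using kills unfolding F_def kills_def by auto
  then show "kills U (n * n) (insert w S)"
    unfolding kills_def using iter by blast
qed

text \<open>Jacobson's strengthening of Engel's theorem: only the members of the bracket-closed set \<open>W\<close>, not
  of its linear span, are assumed to be nilpotent. A maximal bracket-closed subset \<open>S\<close> of \<open>W\<close>
  generating a nilpotent associative algebra is all of \<open>W\<close>, since otherwise some \<open>w\<close> outside \<open>S\<close>
  normalises \<open>S\<close> and could be adjoined.\<close>

theorem engel_bracket_closed:
  fixes W :: "'v::complex_vector endo set"
  assumes U: "dim_at_most n U" and pres: "\<And>x u. x \<in> W \<Longrightarrow> u \<in> U \<Longrightarrow> app x u \<in> U"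
    and closed: "\<And>x y. x \<in> W \<Longrightarrow> y \<in> W \<Longrightarrow> x * y - y * x \<in> W"
    and nil: "\<And>x u. x \<in> W \<Longrightarrow> u \<in> U \<Longrightarrow> \<exists>k. app (x ^ k) u = 0"
    and u0: "u0 \<in> U" "u0 \<noteq> 0"
  obtains u where "u \<in> U" "u \<noteq> 0" "\<And>x. x \<in> W \<Longrightarrow> app x u = 0"
proof -
  define \<C> where "\<C> = {S. S \<subseteq> W \<and> (\<forall>x\<in>S. \<forall>y\<in>S. x * y - y * x \<in> S) \<and> kills U n S}"
  have n: "n \<noteq> 0"
  proof
    assume "n = 0"
    with U have "U \<subseteq> cvec.span {}" unfolding dim_at_most_def by auto
    then show False using u0 by auto
  qed
  have "{} \<in> \<C>" using n unfolding \<C>_def kills_def by auto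
  then have "\<C> \<noteq> {}" by blast
  moreover have "\<Union>K \<in> \<C>" if "K \<noteq> {}" "subset.chain \<C> K" for K
  proof -
    have fin: "\<exists>X\<in>K. A \<subseteq> X" if "finite A" "A \<subseteq> \<Union>K" for A
      by (rule finite_subset_Union_chain[OF that \<open>K \<noteq> {}\<close> \<open>subset.chain \<C> K\<close>]) blast
    have KC: "X \<in> \<C>" if "X \<in> K" for X using that \<open>subset.chain \<C> K\<close> unfolding subset.chain_def by blast
    have "x * y - y * x \<in> \<Union>K" if "x \<in> \<Union>K" "y \<in> \<Union>K" for x y
      using fin[of "{x, y}"] that KC unfolding \<C>_def by auto
    moreover have "kills U n (\<Union>K)"
      unfolding kills_def
    proof (intro allI impI)
      fix xs assume xs: "set xs \<subseteq> \<Union>K \<and> length xs = n"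
      then obtain X where "X \<in> K" "set xs \<subseteq> X" using fin[of "set xs"] by blast
      with KC xs show "\<forall>u\<in>U. app (prod_list xs) u = 0" unfolding \<C>_def kills_def by blast
    qed
    moreover have "\<Union>K \<subseteq> W" using KC unfolding \<C>_def by blast
    ultimately show ?thesis unfolding \<C>_def by blast
  qed
  ultimately obtain S where S: "S \<in> \<C>" and max: "\<And>X. X \<in> \<C> \<Longrightarrow> S \<subseteq> X \<Longrightarrow> X = S"
    using subset_Zorn_nonempty[of \<C>] by blast
  have SW: "S \<subseteq> W" and Sc: "\<And>x y. x \<in> S \<Longrightarrow> y \<in> S \<Longrightarrow> x * y - y * x \<in> S" and Sk: "kills U n S"
    using S unfolding \<C>_def by auto
  \<comment> \<open>By maximality \<open>S\<close> contains all members of \<open>W\<close> that vanish on \<open>U\<close>.\<close>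
  have Z: "z \<in> S" if z: "z \<in> W" "\<And>u. u \<in> U \<Longrightarrow> app z u = 0" for z
  proof -
    let ?Z = "{z \<in> W. \<forall>u\<in>U. app z u = 0}"
    have "x * y - y * x \<in> S \<union> ?Z" if "x \<in> S \<union> ?Z" "y \<in> S \<union> ?Z" for x y
    proof (cases "x \<in> S \<and> y \<in> S")
      case True
      then show ?thesis using Sc by blast
    next
      case False
      moreover have "x \<in> W" "y \<in> W" using that SW by auto
      ultimately show ?thesis using that closed pres by auto
    qed
    moreover have "kills U n (S \<union> ?Z)"
      unfolding kills_def
    proof (intro allI impI ballI)
      fix xs u assume xs: "set xs \<subseteq> S \<union> ?Z \<and> length xs = n" and u: "u \<in> U"
      show "app (prod_list xs) u = 0"
      proof (cases "set xs \<subseteq> S")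
        case True
        then show ?thesis using Sk xs u unfolding kills_def by blast
      next
        case False
        then have "\<exists>x\<in>set xs. x \<in> ?Z" using xs by blast
        then obtain x ys zs where x: "xs = ys @ x # zs" "x \<in> ?Z" by (meson split_list)
        have "app (prod_list zs) u \<in> U"
          by (rule app_prod_list_in[where S = W, OF pres _ u]) (use xs x SW in auto)
        then show ?thesis using x by (simp add: app_prod_list_append)
      qed
    qed
    ultimately have "S \<union> ?Z \<in> \<C>" using SW unfolding \<C>_def by blast
    then have "S \<union> ?Z = S" using max by blast
    then show ?thesis using z by blast
  qed
  have "S = W"
  proof (rule ccontr)
    assume "S \<noteq> W"
    with SW have ex: "\<exists>w. w \<in> W - S" by blast
    \<comment> \<open>If no \<open>w\<close> outside \<open>S\<close> normalised \<open>S\<close>, one could keep bracketing with elements of \<open>S\<close> without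
      entering \<open>S\<close>; but after \<open>2 n\<close> steps the bracket vanishes on \<open>U\<close>.\<close>
    have "\<exists>w\<in>W - S. \<forall>s\<in>S. w * s - s * w \<in> S \<and> s * w - w * s \<in> S"
    proof (rule ccontr)
      assume neg: "\<not> ?thesis"
      have "\<exists>w\<in>W - S. \<forall>xs ys. set xs \<subseteq> S \<and> set ys \<subseteq> S \<and> 2 * n \<le> length xs + length ys + k \<longrightarrow>
        (\<forall>u\<in>U. app (prod_list xs) (app w (app (prod_list ys) u)) = 0)" for k
      proof (induction k)
        case 0
        obtain w where w: "w \<in> W - S" using ex by blast
        have "app (prod_list xs) (app w (app (prod_list ys) u)) = 0"
          if "set xs \<subseteq> S" "set ys \<subseteq> S" "2 * n \<le> length xs + length ys" "u \<in> U" for xs ys u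
        proof (cases "n \<le> length ys")
          case True
          then have "app (prod_list ys) u = 0" by (intro kills_length_ge[OF Sk]) (use that in auto)
          then show ?thesis by simp
        next
          case False
          have "app (prod_list ys) u \<in> U"
            by (rule app_prod_list_in[where S = W, OF pres _ that(4)]) (use that SW in auto)
          with w pres have "app w (app (prod_list ys) u) \<in> U" by blast
          then show ?thesis by (intro kills_length_ge[OF Sk]) (use that False in auto)
        qed
        with w show ?case by (intro bexI[of _ w]) auto
      next
        case (Suc k)
        then obtain w where w: "w \<in> W - S" and
          IH: "\<And>xs ys u. set xs \<subseteq> S \<Longrightarrow> set ys \<subseteq> S \<Longrightarrow> 2 * n \<le> length xs + length ys + k \<Longrightarrow> u \<in> U
            \<Longrightarrow> app (prod_list xs) (app w (app (prod_list ys) u)) = 0" by blast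
        obtain s where s: "s \<in> S" "w * s - s * w \<notin> S \<or> s * w - w * s \<notin> S" using neg w by blast
        have sw: "s \<in> W" "w \<in> W" using s w SW by auto
        have 1: "app (prod_list xs) (app w (app s (app (prod_list ys) u))) = 0"
           "app (prod_list xs) (app s (app w (app (prod_list ys) u))) = 0"
          if "set xs \<subseteq> S" "set ys \<subseteq> S" "2 * n \<le> length xs + length ys + Suc k" "u \<in> U" for xs ys u
          using IH[of xs "s # ys" u] IH[of "xs @ [s]" ys u] that s(1)
          by (simp_all add: app_prod_list_append)
        from s(2) show ?case
        proof
          assume "w * s - s * w \<notin> S"
          with closed[OF sw(2,1)] show ?thesis
            by (intro bexI[of _ "w * s - s * w"]) (auto simp: 1)
        next
          assume "s * w - w * s \<notin> S"
          with closed[OF sw] show ?thesis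
            by (intro bexI[of _ "s * w - w * s"]) (auto simp: 1)
        qed
      qed
      from this[of "2 * n"] obtain w where w: "w \<in> W - S" and
        a: "\<And>xs ys u. set xs \<subseteq> S \<Longrightarrow> set ys \<subseteq> S \<Longrightarrow> u \<in> U
            \<Longrightarrow> app (prod_list xs) (app w (app (prod_list ys) u)) = 0" by auto
      from a[of "[]" "[]"] have "app w u = 0" if "u \<in> U" for u using that by simp
      with Z[of w] w show False by blast
    qed
    then obtain w where w: "w \<in> W" "w \<notin> S" and
      norm: "\<And>s. s \<in> S \<Longrightarrow> w * s - s * w \<in> S" "\<And>s. s \<in> S \<Longrightarrow> s * w - w * s \<in> S" by blast
    have "kills U n (insert w S)"
      by (rule kills_insert[OF U _ Sk norm(2) nil]) (use w SW pres in auto)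
    moreover have "w * w - w * w \<in> S" using closed[OF w(1) w(1)] by (intro Z) auto
    ultimately have "insert w S \<in> \<C>" using norm SW w Sc unfolding \<C>_def by auto
    then show False using max[of "insert w S"] w by blast
  qed
  then have Wk: "kills U n W" using Sk by simp
  obtain ys where ys: "set ys \<subseteq> W" "app (prod_list ys) u0 \<noteq> 0"
    "\<And>zs. set zs \<subseteq> W \<Longrightarrow> length ys < length zs \<Longrightarrow> app (prod_list zs) u0 = 0"
    using longest_nonvanishing_product[OF Wk u0] by blast
  show ?thesis
  proof (rule that)
    show "app (prod_list ys) u0 \<in> U" by (rule app_prod_list_in[OF pres ys(1) u0(1)])
    show "app (prod_list ys) u0 \<noteq> 0" by (rule ys(2))
    show "app x (app (prod_list ys) u0) = 0" if "x \<in> W" for x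
      using ys(3)[of "x # ys"] ys(1) that by simp
  qed
qed

section \<open>Nilpotent operators and commutators\<close>

lemma commute_power: "f * g = g * f \<Longrightarrow> f ^ k * g = g * (f ^ k :: 'v::complex_vector endo)"
  by (simp add: power_commuting_commutes)

lemma power_mult_commuting:
  fixes f g :: "'v::complex_vector endo"
  assumes "f * g = g * f"
  shows "(f * g) ^ k = f ^ k * g ^ k"
proof (induction k)
  case (Suc k)
  have "(f * g) ^ Suc k = f * (g * f ^ k) * g ^ k" by (simp add: Suc mult.assoc)
  also have "g * f ^ k = f ^ k * g" by (rule commute_power[OF assms, symmetric])
  finally show ?case by (simp add: mult.assoc)
qed simp

lemma commutator_mult:
  fixes A f g :: "'v::complex_vector endo"
  shows "A * (f * g) - (f * g) * A = (A * f - f * A) * g + f * (A * g - g * A)"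
  by (simp add: algebra_simps)

lemma commutator_power:
  fixes A f D :: "'v::complex_vector endo"
  assumes D: "A * f - f * A = D" and fD: "f * D = D * f"
  shows "A * f ^ Suc k - f ^ Suc k * A = of_nat (Suc k) *\<^sub>C (f ^ k * D)"
proof (induction k)
  case 0
  show ?case by (simp add: D scaleC_one)
next
  case (Suc k)
  have "A * f ^ Suc (Suc k) - f ^ Suc (Suc k) * A
      = D * f ^ Suc k + f * (A * f ^ Suc k - f ^ Suc k * A)"
    using commutator_mult[of A f "f ^ Suc k"] D by simp
  also have "D * f ^ Suc k = f ^ Suc k * D" by (rule commute_power[OF fD, symmetric])
  also have "f * (A * f ^ Suc k - f ^ Suc k * A) = of_nat (Suc k) *\<^sub>C (f ^ Suc k * D)"
    unfolding Suc by (simp add: mult.assoc)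
  finally show ?case by (simp only: of_nat_Suc scaleC_add_left scaleC_one)
qed

lemma commutator_power_mult:
  fixes A f D :: "'v::complex_vector endo"
  assumes D: "A * f - f * A = D" and fD: "f * D = D * f"
  shows "(A * f ^ k - f ^ k * A) * f = of_nat k *\<^sub>C (f ^ k * D)"
proof (cases k)
  case (Suc m)
  then show ?thesis
    by (simp only: commutator_power[OF D fD] endo_scaleC mult.assoc fD[symmetric])
       (simp add: mult.assoc[symmetric] power_commutes)
qed simp

lemma nilpotent_add:
  fixes f g :: "'v::complex_vector endo"
  assumes fg: "f * g = g * f" and f: "f ^ m = 0" and g: "g ^ n = 0"
  shows "(f + g) ^ (m + n) = 0"
proof -
  have pz: "h ^ i = 0" if "h ^ m = 0" "m \<le> i" for h :: "'v endo" and i m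
    using that by (metis le_add_diff_inverse mult_zero_left power_add)
  have "f ^ i * g ^ j * (f + g) ^ k = 0" if "m + n \<le> i + j + k" for i j k
    using that
  proof (induction k arbitrary: i j)
    case 0
    then have "m \<le> i \<or> n \<le> j" by auto
    then show ?case using pz[OF f] pz[OF g] by auto
  next
    case (Suc k)
    have "f ^ i * g ^ j * f = f ^ Suc i * g ^ j"
      by (simp only: mult.assoc commute_power[OF fg[symmetric]])
        (simp add: mult.assoc[symmetric] power_commutes)
    then have "f ^ i * g ^ j * (f + g) ^ Suc k
        = f ^ Suc i * g ^ j * (f + g) ^ k + f ^ i * g ^ Suc j * (f + g) ^ k"
      by (simp add: distrib_left distrib_right mult.assoc[symmetric]) (simp add: mult.assoc power_commutes)
    then show ?case using Suc.IH[of "Suc i" j] Suc.IH[of i "Suc j"] Suc.prems by simp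
  qed
  from this[of 0 0 "m + n"] show ?thesis by simp
qed

text \<open>The radical of an ideal is stable under derivations, here for the derivation \<open>[A, \<cdot>]\<close>.\<close>

lemma nilpotent_derivation:
  fixes A f D E :: "'v::complex_vector endo"
  assumes D: "A * f - f * A = D" and E: "A * D - D * A = E"
    and fD: "f * D = D * f" and DE: "D * E = E * D" and f: "f ^ k = 0"
  shows "D ^ (2 * k) = 0"
proof -
  have "f ^ (k - j) * D ^ (2 * j) = 0" if "j \<le> k" for j
    using that
  proof (induction j)
    case 0
    then show ?case using f by simp
  next
    case (Suc j)
    let ?m = "k - Suc j"
    have m: "k - j = Suc ?m" using Suc.prems by simp
    \<comment> \<open>Differentiate this and multiply by \<open>D\<close>, so that the term with \<open>E\<close> vanishes by the same
      relation.\<close>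
    have z: "f ^ Suc ?m * D ^ (2 * j) = 0" using Suc m by simp
    have "0 = (A * (f ^ Suc ?m * D ^ (2 * j)) - (f ^ Suc ?m * D ^ (2 * j)) * A) * D"
      by (simp only: z) simp
    also have "\<dots> = (A * f ^ Suc ?m - f ^ Suc ?m * A) * D ^ (2 * j) * D
        + f ^ Suc ?m * ((A * D ^ (2 * j) - D ^ (2 * j) * A) * D)"
      by (subst commutator_mult) (simp only: distrib_right mult.assoc)
    also have "f ^ Suc ?m * ((A * D ^ (2 * j) - D ^ (2 * j) * A) * D) = 0"
      unfolding commutator_power_mult[OF E DE]
      using z by (simp only: endo_scaleC mult.assoc[symmetric]) simp
    also have "(A * f ^ Suc ?m - f ^ Suc ?m * A) * D ^ (2 * j) * D
        = of_nat (Suc ?m) *\<^sub>C (f ^ ?m * D ^ (2 * Suc j))"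
      unfolding commutator_power[OF D fD]
      by (simp add: mult.assoc) (simp add: power_commutes mult.assoc[symmetric])
    finally have "of_nat (Suc ?m) *\<^sub>C (f ^ ?m * D ^ (2 * Suc j)) = 0" by (simp only: add_0_right)
    then show ?case by (metis cvec.scale_eq_0_iff of_nat_neq_0)
  qed
  from this[of k] show ?thesis by simp
qed

text \<open>The value of a complex polynomial at an operator.\<close>

definition peval :: "complex poly \<Rightarrow> 'v::complex_vector endo \<Rightarrow> 'v endo"
  where "peval p B = fold_coeffs (\<lambda>a f. a *\<^sub>C 1 + B * f) p 0"

lemma peval_0 [simp]: "peval 0 B = 0"
  by (simp add: peval_def)

lemma peval_pCons [simp]: "peval (pCons a p) B = a *\<^sub>C 1 + B * peval p B"
  by (cases "a = 0 \<and> p = 0") (auto simp: peval_def)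

lemma peval_add: "peval (p + q) B = peval p B + peval q B"
  by (induction p q rule: poly_induct2) (simp_all add: scaleC_add_left algebra_simps)

lemma peval_smult: "peval (smult c p) B = c *\<^sub>C peval p B"
  by (induction p) (simp_all add: scaleC_add_right scaleC_scaleC)

lemma peval_diff: "peval (p - q) B = peval p B - peval q B"
  using peval_add[of "p - q" q B] by simp

lemma peval_mult: "peval (p * q) B = peval p B * peval q B"
  by (induction p) (simp_all add: peval_add peval_smult algebra_simps)

lemma peval_monom: "peval (monom c i) B = c *\<^sub>C B ^ i"
  by (induction i) (simp_all add: monom_0 monom_Suc)

lemma peval_commute: "B * C = C * B \<Longrightarrow> peval p B * C = C * peval p B"
proof (induction p)
  case (pCons a p)
  have "B * peval p B * C = B * (C * peval p B)" using pCons by (simp add: mult.assoc)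
  also have "\<dots> = C * (B * peval p B)" by (simp only: mult.assoc[symmetric] pCons.prems)
  finally show ?case by (simp add: distrib_left distrib_right)
qed simp

lemma commutator_peval:
  assumes C: "A * B - B * A = C" and BC: "B * C = C * B"
  shows "A * peval p B - peval p B * A = peval (pderiv p) B * C"
proof (induction p)
  case (pCons a p)
  have "A * peval (pCons a p) B - peval (pCons a p) B * A = A * (B * peval p B) - (B * peval p B) * A"
    by (simp add: algebra_simps)
  also have "\<dots> = C * peval p B + B * (peval (pderiv p) B * C)"
    unfolding commutator_mult C pCons.IH ..
  also have "\<dots> = peval (pderiv (pCons a p)) B * C"
    by (simp add: pderiv_pCons peval_add peval_commute[OF BC] algebra_simps)
  finally show ?case .
qed simp

lemma annihilating_poly:
  assumes U: "dim_at_most n U" and pres: "\<And>u. u \<in> U \<Longrightarrow> app B u \<in> U"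
  obtains p where "p \<noteq> 0" "\<And>u. u \<in> U \<Longrightarrow> app (peval p B) u = 0"
proof -
  have local: "\<exists>p. p \<noteq> 0 \<and> app (peval p B) u = 0" if u: "u \<in> U" for u
  proof -
    have pow: "app (B ^ i) u \<in> U" for i by (induction i) (simp_all add: u pres)
    obtain j where j: "app (B ^ j) u \<in> cvec.span ((\<lambda>i. app (B ^ i) u) ` {..<j})"
      by (rule dim_at_most_dependent[OF U, of "\<lambda>i. app (B ^ i) u"]) (auto simp: pow)
    define Q where "Q = {w. \<exists>q. (\<forall>i\<ge>j. coeff q i = 0) \<and> w = app (peval q B) u}"
    have "cvec.subspace Q"
      unfolding cvec.subspace_def
    proof (intro conjI ballI allI)
      show "0 \<in> Q" unfolding Q_def by (auto intro!: exI[of _ 0])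
    next
      fix x y assume "x \<in> Q" "y \<in> Q"
      then obtain p q where "\<forall>i\<ge>j. coeff p i = 0" "x = app (peval p B) u"
        "\<forall>i\<ge>j. coeff q i = 0" "y = app (peval q B) u" unfolding Q_def by blast
      then show "x + y \<in> Q" unfolding Q_def by (auto intro!: exI[of _ "p + q"] simp: peval_add)
    next
      fix c x assume "x \<in> Q"
      then obtain p where "\<forall>i\<ge>j. coeff p i = 0" "x = app (peval p B) u" unfolding Q_def by blast
      then show "c *\<^sub>C x \<in> Q" unfolding Q_def by (auto intro!: exI[of _ "smult c p"] simp: peval_smult)
    qed
    moreover have "app (B ^ i) u \<in> Q" if "i < j" for i
      unfolding Q_def using that by (auto intro!: exI[of _ "monom 1 i"] simp: peval_monom scaleC_one)
    then have "(\<lambda>i. app (B ^ i) u) ` {..<j} \<subseteq> Q" by blast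
    ultimately have "app (B ^ j) u \<in> Q" using j cvec.span_minimal by blast
    then obtain q where q: "\<forall>i\<ge>j. coeff q i = 0" "app (B ^ j) u = app (peval q B) u"
      unfolding Q_def by blast
    have "coeff (monom 1 j - q) j = 1" using q(1) by simp
    then have "monom 1 j - q \<noteq> 0" by (metis coeff_0 zero_neq_one)
    moreover have "app (peval (monom 1 j - q) B) u = 0"
      using q(2) by (simp add: peval_diff peval_monom scaleC_one)
    ultimately show ?thesis by blast
  qed
  have fin: "\<exists>p. p \<noteq> 0 \<and> (\<forall>u\<in>F. app (peval p B) u = 0)" if "finite F" "F \<subseteq> U" for F
    using that
  proof (induction F)
    case empty
    show ?case by (intro exI[of _ 1]) simp
  next
    case (insert u F)
    then obtain p where p: "p \<noteq> 0" "\<forall>u\<in>F. app (peval p B) u = 0" by auto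
    obtain q where q: "q \<noteq> 0" "app (peval q B) u = 0" using local insert.prems by blast
    have "app (peval (p * q) B) v = 0" if "v \<in> insert u F" for v
    proof (cases "v = u")
      case True
      then show ?thesis using q by (simp add: peval_mult)
    next
      case False
      then have "app (peval (q * p) B) v = 0" using that p by (simp add: peval_mult)
      then show ?thesis by (simp add: mult.commute)
    qed
    with p q show ?case by (intro exI[of _ "p * q"]) simp
  qed
  obtain F where F: "F \<subseteq> U" "cvec.independent F" "U \<subseteq> cvec.span F"
    using cvec.maximal_independent_subset by blast
  obtain S where S: "finite S" "U \<subseteq> cvec.span S" using U unfolding dim_at_most_def by blast
  have "finite F"
    using cvec.independent_span_bound[OF S(1) F(2) order_trans[OF F(1) S(2)]] by simp
  from fin[OF this F(1)] obtain p where p: "p \<noteq> 0" "\<forall>u\<in>F. app (peval p B) u = 0"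
    by (elim exE conjE)
  then have "F \<subseteq> {u. app (peval p B) u = 0}" by auto
  then have "cvec.span F \<subseteq> {u. app (peval p B) u = 0}"
    by (rule cvec.span_minimal) (rule subspace_app_kernel)
  with F(3) show ?thesis by (intro that[OF p(1)]) auto
qed

text \<open>Jacobson's lemma: on a finite-dimensional space a commutator \<open>C = [A, B]\<close> that commutes with
  \<open>B\<close> is nilpotent. Bracketing \<open>p(B) C ^ e = 0\<close> with \<open>A\<close> replaces \<open>p\<close> by its derivative at the cost of
  higher powers of \<open>C\<close>, until \<open>p\<close> is a nonzero constant. The additional hypothesis that \<open>[A, C]\<close>
  commutes with \<open>C\<close> simplifies this computation.\<close>

lemma nilpotent_commutator:
  assumes U: "dim_at_most n U"
    and pres: "\<And>u. u \<in> U \<Longrightarrow> app A u \<in> U" "\<And>u. u \<in> U \<Longrightarrow> app B u \<in> U"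
      "\<And>u. u \<in> U \<Longrightarrow> app C u \<in> U" "\<And>u. u \<in> U \<Longrightarrow> app D u \<in> U"
    and C: "A * B - B * A = C" and BC: "B * C = C * B"
    and D: "A * C - C * A = D" and CD: "C * D = D * C"
  obtains k where "\<And>u. u \<in> U \<Longrightarrow> app (C ^ k) u = 0"
proof -
  have "\<exists>k. \<forall>u\<in>U. app (C ^ k) u = 0"
    if "p \<noteq> 0" "\<forall>u\<in>U. app (peval p B * C ^ e) u = 0" for p e
    using that
  proof (induction "degree p" arbitrary: p e rule: less_induct)
    case less
    show ?case
    proof (cases "degree p = 0")
      case True
      then obtain a where "p = [:a:]" by (metis degree_eq_zeroE)
      then show ?thesis using less.prems by (intro exI[of _ e]) auto
    next
      case False
      let ?P = "peval p B" and ?P' = "peval (pderiv p) B"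
      have z: "app (?P * C ^ e) u = 0" if "u \<in> U" for u using less.prems that by blast
      have "app (?P' * C ^ Suc (Suc e)) u = 0" if u: "u \<in> U" for u
      proof -
        have "(A * (?P * C ^ e) - ?P * C ^ e * A) * C
            = ?P' * C * C ^ e * C + ?P * ((A * C ^ e - C ^ e * A) * C)"
          by (subst commutator_mult) (simp only: commutator_peval[OF C BC] distrib_right mult.assoc)
        also have "\<dots> = ?P' * C ^ Suc (Suc e) + of_nat e *\<^sub>C (?P * C ^ e * D)"
          by (simp add: commutator_power_mult[OF D CD] mult.assoc power_commutes)
        finally have "app ((A * (?P * C ^ e) - ?P * C ^ e * A) * C) u
            = app (?P' * C ^ Suc (Suc e) + of_nat e *\<^sub>C (?P * C ^ e * D)) u" by simp
        moreover have "app ((A * (?P * C ^ e) - ?P * C ^ e * A) * C) u = 0"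
          using z[OF pres(3)[OF u]] z[OF pres(1)[OF pres(3)[OF u]]] by simp
        moreover have "app (of_nat e *\<^sub>C (?P * C ^ e * D)) u = 0"
          using z[OF pres(4)[OF u]] by simp
        ultimately show ?thesis by auto
      qed
      moreover have "degree (pderiv p) < degree p" "pderiv p \<noteq> 0"
        using False by (simp_all add: degree_pderiv pderiv_eq_0_iff)
      ultimately show ?thesis using less.hyps by blast
    qed
  qed
  moreover obtain p where "p \<noteq> 0" "\<And>u. u \<in> U \<Longrightarrow> app (peval p B) u = 0"
    using annihilating_poly[of n U B] U pres(2) by blast
  ultimately show ?thesis using that by (metis mult.right_neutral power_0)
qed

section \<open>The symplectic form on the lattice\<close>

text \<open>\<open>symp q s\<close> is the integer \<open>(q\<bar>, s)\<close>, the standard symplectic form on the lattice.\<close>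

definition symp :: "int ^ ('m + 'm::finite) \<Rightarrow> int ^ ('m + 'm) \<Rightarrow> int"
  where "symp q s = (\<Sum>i\<in>UNIV. rbar q $ i * s $ i)"

lemma pairing_eq_symp: "pairing (cvec_of_int (rbar q)) s = of_int (symp q s)"
  by (simp add: pairing_def symp_def)

lemma symp_antisym: "symp s q = - symp q s"
proof -
  have "(of_int (symp s q) :: complex) = of_int (- symp q s)"
    using pairing_cvec_rbar[of s q] by (simp add: pairing_eq_symp)
  then show ?thesis by (simp only: of_int_eq_iff)
qed

lemma symp_add_right [simp]: "symp q (r + s) = symp q r + symp q s"
  by (simp add: symp_def distrib_left sum.distrib)

lemma symp_add_left [simp]: "symp (q + r) s = symp q s + symp r s"
  using symp_antisym[of s "q + r"] symp_antisym[of s q] symp_antisym[of s r] by simp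

lemma symp_self [simp]: "symp r r = 0"
  using symp_antisym[of r r] by simp

lemma symp_minus_right [simp]: "symp q (- s) = - symp q s"
  by (simp add: symp_def sum_negf)

lemma symp_minus_left [simp]: "symp (- q) s = - symp q s"
  using symp_antisym[of s "- q"] symp_antisym[of s q] by simp

lemma symp_diff_right [simp]: "symp q (r - s) = symp q r - symp q s"
  using symp_add_right[of q r "- s"] by simp

lemma symp_diff_left [simp]: "symp (q - r) s = symp q s - symp r s"
  using symp_add_left[of q "- r" s] by simp

lemma symp_zero_right [simp]: "symp q 0 = 0"
  by (simp add: symp_def)

lemma symp_eq_0_if_sum_0: "q + s = 0 \<Longrightarrow> symp q s = 0"
  using symp_add_right[of q q s] by simp

lemma symp_axis: "symp q (axis i 1) = rbar q $ i"
  by (simp add: symp_def axis_def if_distrib[of "\<lambda>x. _ * x"] cong: if_cong)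

lemma symp_axis_nonzero:
  assumes "q \<noteq> 0"
  obtains i where "symp q (axis i 1) \<noteq> 0"
proof -
  obtain i where i: "q $ i \<noteq> 0" using assms by (auto simp: vec_eq_iff)
  show ?thesis
  proof (cases i)
    case (Inl j)
    then have "rbar q $ Inr j \<noteq> 0" using i by (simp add: rbar_def)
    then show ?thesis using that[of "Inr j"] by (simp add: symp_axis)
  next
    case (Inr j)
    then have "rbar q $ Inl j \<noteq> 0" using i by (simp add: rbar_def)
    then show ?thesis using that[of "Inl j"] by (simp add: symp_axis)
  qed
qed

lemma symp_avoid_two:
  assumes "r \<noteq> 0" "s \<noteq> 0"
  obtains p where "symp p r \<noteq> 0" "symp p s \<noteq> 0"
proof -
  obtain i where i: "symp r (axis i 1) \<noteq> 0" using symp_axis_nonzero[OF assms(1)] .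
  obtain j where j: "symp s (axis j 1) \<noteq> 0" using symp_axis_nonzero[OF assms(2)] .
  define x where "x = (axis i 1 :: int ^ _)"
  define y where "y = (axis j 1 :: int ^ _)"
  have xy: "symp x r \<noteq> 0" "symp y s \<noteq> 0"
    using i j symp_antisym[of _ x] symp_antisym[of _ y] unfolding x_def y_def by auto
  consider "symp x s \<noteq> 0" | "symp y r \<noteq> 0" | "symp x s = 0" "symp y r = 0" by blast
  then show ?thesis
  proof cases
    case 3
    then show ?thesis using that[of "x + y"] xy by simp
  qed (use that xy in blast)+
qed

section \<open>Generators of the Lie algebra\<close>

lemma hamD_0: "hamD 0 = 0"
  by transfer (auto simp: vec_eq_iff rbar_def split: sum.split)

lemma pairing_axis: "pairing (axis i 1) s = of_int (s $ i)"
  by (simp add: pairing_def axis_def if_distrib[of "\<lambda>y. y * _"] cong: if_cong)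

lemma pairing_zero: "pairing u 0 = 0"
  by (simp add: pairing_def)

lemma lie_bracket_hamd_hamD: "lie_bracket (hamd i) (hamD s) = of_int (s $ i) *\<^sub>C hamD s"
  by transfer (auto simp: vf_d_def vf_bracket_D pairing_axis pairing_zero vf_D_linear vf_apply_right)

lemma lie_bracket_hamd_hamd: "lie_bracket (hamd i) (hamd j) = 0"
  by transfer (auto simp: vf_d_def vf_bracket_D pairing_zero vec_eq_iff vf_apply_right)

lemma ham_laurent_generators:
  "cvec.span (range hamD \<union> range hamd \<union> range tmon) = (UNIV :: 'm::finite ham_laurent set)"
    (is "?G = UNIV")
proof -
  have addA: "Abs_ham_laurent (X + Y, f + g) = Abs_ham_laurent (X, f) + Abs_ham_laurent (Y, g)"
    if "X \<in> ham_tilde" "Y \<in> ham_tilde" for X Y :: "('m + 'm) vector_field" and f g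
    using that by (simp add: plus_ham_laurent.abs_eq eq_onp_def)
  have scale: "Abs_ham_laurent (c *\<^sub>C X, c *\<^sub>C f) = c *\<^sub>C Abs_ham_laurent (X, f)"
    if "X \<in> ham_tilde" for X :: "('m + 'm) vector_field" and c f
    using that by (simp add: scaleC_ham_laurent.abs_eq eq_onp_def)
  have zeroA: "(0 :: ('m + 'm) vector_field) \<in> ham_tilde"
    by (rule cvec.subspace_0[OF subspace_ham_tilde])
  have field: "Abs_ham_laurent (X, 0) \<in> ?G" if "X \<in> ham_tilde" for X :: "('m + 'm) vector_field"
  proof -
    let ?Z = "{X \<in> ham_tilde. Abs_ham_laurent (X, 0) \<in> ?G}"
    have "cvec.subspace ?Z"
      unfolding cvec.subspace_def
    proof (intro conjI ballI allI)
      have "Abs_ham_laurent (0, 0) = (0 :: 'm ham_laurent)" by (simp add: zero_ham_laurent_def)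
      then show "0 \<in> ?Z" by (simp add: zeroA cvec.span_zero)
    next
      fix X Y :: "('m + 'm) vector_field" assume "X \<in> ?Z" "Y \<in> ?Z"
      then show "X + Y \<in> ?Z"
        using addA[of X Y 0 0] by (simp add: cvec.subspace_add[OF subspace_ham_tilde] cvec.span_add)
    next
      fix c and X :: "('m + 'm) vector_field" assume "X \<in> ?Z"
      then show "c *\<^sub>C X \<in> ?Z"
        using scale[of X c 0] by (simp add: cvec.subspace_scale[OF subspace_ham_tilde] cvec.span_scale)
    qed
    moreover have "range (\<lambda>r. vf_D (cvec_of_int (rbar r)) r) \<union> range vf_d \<subseteq> ?Z"
    proof -
      have "vf_D (cvec_of_int (rbar r)) r \<in> ?Z" for r
        using cvec.span_base[of "hamD r" "range hamD \<union> range hamd \<union> range tmon"]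
        by (simp add: hamD_def) (auto simp: ham_tilde_eq_span intro: cvec.span_base)
      moreover have "vf_d i \<in> ?Z" for i
        using cvec.span_base[of "hamd i" "range hamD \<union> range hamd \<union> range tmon"]
        by (simp add: hamd_def) (auto simp: ham_tilde_eq_span intro: cvec.span_base)
      ultimately show ?thesis by blast
    qed
    ultimately have "ham_tilde \<subseteq> ?Z" unfolding ham_tilde_eq_span by (metis (lifting) cvec.span_minimal)
    then show ?thesis using that by blast
  qed
  have laurent: "Abs_ham_laurent (0, f) \<in> ?G" for f :: "('m + 'm) laurent"
  proof (induction f rule: laurent_induct)
    case zero
    show ?case by (rule field[OF zeroA])
  next
    case (add k c f)
    have "Abs_ham_laurent (0, Poly_Mapping.single k c) = c *\<^sub>C tmon k"
      using scale[OF zeroA, of c "Poly_Mapping.single k 1"] by (simp add: tmon_def scaleC_single)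
    moreover have "c *\<^sub>C tmon k \<in> ?G" by (intro cvec.span_scale cvec.span_base) auto
    ultimately show ?case
      using addA[OF zeroA zeroA, of "Poly_Mapping.single k c" f] add.IH cvec.span_add by auto
  qed
  have "x \<in> ?G" for x
  proof -
    obtain X f where x: "x = Abs_ham_laurent (X, f)" "X \<in> ham_tilde"
      by (metis Abs_ham_laurent_cases SigmaE)
    then have "x = Abs_ham_laurent (X, 0) + Abs_ham_laurent (0, f)" using addA[of X 0 0 f] zeroA by simp
    then show ?thesis using field[OF x(2)] laurent[of f] cvec.span_add by simp
  qed
  then show ?thesis by blast
qed

lemma tensor_generators:
  fixes Z :: "('m::finite ham_laurent, 'b::complex_comm_algebra) tensor set"
  assumes Z: "cvec.subspace Z"
    and gen: "\<And>r b. hamD r \<otimes>\<^sub>C b \<in> Z" "\<And>i b. hamd i \<otimes>\<^sub>C b \<in> Z" "\<And>r b. tmon r \<otimes>\<^sub>C b \<in> Z"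
  shows "x \<in> Z"
proof (induction x rule: tensor_induct)
  case zero
  show ?case by (rule cvec.subspace_0[OF Z])
next
  case (add y b t)
  have tzl: "(0::'m ham_laurent) \<otimes>\<^sub>C b = 0" using tensor_scaleC_left[of 0 "0::'m ham_laurent" b] by simp
  have "cvec.subspace {y. y \<otimes>\<^sub>C b \<in> Z}"
    using Z by (auto simp: cvec.subspace_def tensor_add_left tensor_scaleC_left tzl)
  moreover have "range hamD \<union> range hamd \<union> range tmon \<subseteq> {y. y \<otimes>\<^sub>C b \<in> Z}" using gen by auto
  ultimately have "y \<in> {y. y \<otimes>\<^sub>C b \<in> Z}"
    using cvec.span_minimal ham_laurent_generators by blast
  with add show ?case by (simp add: cvec.subspace_add[OF Z])
qed

section \<open>The operators on the module\<close>

text \<open>An irreducible uniformly bounded module on which some \<open>t\<^sup>s\<close> with \<open>s \<noteq> 0\<close> acts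
  nontrivially and \<open>t\<^sup>r b\<close> acts as \<open>\<psi> b t\<^sup>r\<close> for \<open>r \<noteq> 0\<close>.\<close>

locale ham_module =
  fixes \<rho> :: "('m::finite ham_laurent, 'b::complex_comm_algebra) tensor
                \<Rightarrow> 'v::complex_vector \<Rightarrow> 'v"
    and \<psi> :: "'b \<Rightarrow> complex"
  assumes irr: "irreducible_lie_module \<rho>"
    and HC: "uniformly_bounded_HC_module \<rho>"
    and nontrivial: "\<exists>s. s \<noteq> 0 \<and> (\<exists>v. \<rho> (tmon s \<otimes>\<^sub>C 1) v \<noteq> 0)"
    and psi: "algebra_hom \<psi>"
    and tmon_psi: "r \<noteq> 0 \<Longrightarrow> \<rho> (tmon r \<otimes>\<^sub>C b) v = \<psi> b *\<^sub>C \<rho> (tmon r \<otimes>\<^sub>C 1) v"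
begin

text \<open>\<open>E x\<close> is the action of \<open>x\<close> as an element of the endomorphism ring; \<open>T s\<close>, \<open>X s b\<close> and \<open>H i b\<close>
  are the actions of \<open>t\<^sup>s\<close>, \<open>D(s\<bar>, s) b\<close> and \<open>d\<^sub>i b\<close>.\<close>

definition E :: "('m ham_laurent, 'b) tensor \<Rightarrow> 'v endo"
  where "E x = Endo (\<rho> x)"

definition T :: "int ^ ('m + 'm) \<Rightarrow> 'v endo"
  where "T s = E (tmon s \<otimes>\<^sub>C 1)"

definition X :: "int ^ ('m + 'm) \<Rightarrow> 'b \<Rightarrow> 'v endo"
  where "X s b = E (hamD s \<otimes>\<^sub>C b)"

definition H :: "'m + 'm \<Rightarrow> 'b \<Rightarrow> 'v endo"
  where "H i b = E (hamd i \<otimes>\<^sub>C b)"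

lemma lie_module: "lie_module \<rho>"
  using irr unfolding irreducible_lie_module_def by blast

lemma app_E [simp]: "app (E x) v = \<rho> x v"
  unfolding E_def by (subst Endo_inverse) (simp_all add: lie_module.clinear_right[OF lie_module])

lemma E_add: "E (x + y) = E x + E y" and E_scale: "E (c *\<^sub>C x) = c *\<^sub>C E x"
  using lie_module.clinear_left[OF lie_module] by (auto intro!: endo_eqI simp: clinear_iff)

lemma E_0: "E 0 = 0"
  using E_scale[of 0 0] by simp

lemma E_bracket: "E x * E y - E y * E x = E (lie_bracket x y)"
  by (rule endo_eqI) (simp add: lie_module.bracket[OF lie_module])

lemma tensor_0_left: "(0 :: 'm ham_laurent) \<otimes>\<^sub>C (b :: 'b) = 0"
  using tensor_scaleC_left[of 0 "0::'m ham_laurent" b] by simp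

lemma E_pure_bracket:
  "E (x \<otimes>\<^sub>C b) * E (y \<otimes>\<^sub>C c) - E (y \<otimes>\<^sub>C c) * E (x \<otimes>\<^sub>C b) = E (lie_bracket x y \<otimes>\<^sub>C (b * c))"
  by (simp add: E_bracket lie_bracket_pure)

lemma E_pure_scale: "E ((c *\<^sub>C x) \<otimes>\<^sub>C b) = c *\<^sub>C E (x \<otimes>\<^sub>C b)"
  by (simp add: tensor_scaleC_left E_scale)

lemma E_tmon: "r \<noteq> 0 \<Longrightarrow> E (tmon r \<otimes>\<^sub>C b) = \<psi> b *\<^sub>C T r"
  unfolding T_def by (rule endo_eqI) (simp only: app_simps app_E, rule tmon_psi)

lemma psi_simps [simp]: "\<psi> 1 = 1" "\<psi> (b * c) = \<psi> b * \<psi> c" "\<psi> (a *\<^sub>C b) = a * \<psi> b"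
  "\<psi> (b - c) = \<psi> b - \<psi> c"
  using psi unfolding algebra_hom_def by (auto simp: clinear_diff) (auto simp: clinear_iff scaleC_complex_def)

lemma tmon_tmon_commute: "E (tmon r \<otimes>\<^sub>C b) * E (tmon s \<otimes>\<^sub>C c) = E (tmon s \<otimes>\<^sub>C c) * E (tmon r \<otimes>\<^sub>C b)"
  using E_pure_bracket[of "tmon r" b "tmon s" c] by (simp add: lie_bracket_tmon_tmon tensor_0_left E_0)

lemma X_tmon:
  "X q c * E (tmon s \<otimes>\<^sub>C b) - E (tmon s \<otimes>\<^sub>C b) * X q c = (of_int (symp q s) * (\<psi> c * \<psi> b)) *\<^sub>C T (q + s)"
proof -
  have "X q c * E (tmon s \<otimes>\<^sub>C b) - E (tmon s \<otimes>\<^sub>C b) * X q c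
      = of_int (symp q s) *\<^sub>C E (tmon (q + s) \<otimes>\<^sub>C (c * b))"
    unfolding X_def E_pure_bracket lie_bracket_hamD_tmon pairing_eq_symp E_pure_scale ..
  then show ?thesis
    by (cases "q + s = 0") (simp_all add: symp_eq_0_if_sum_0 E_tmon scaleC_scaleC)
qed

lemma X_T: "X q c * T s - T s * X q c = (of_int (symp q s) * \<psi> c) *\<^sub>C T (q + s)"
  using X_tmon[of q c s 1] by (simp add: T_def)

lemma H_T: "H i c * T s - T s * H i c = (of_int (s $ i) * \<psi> c) *\<^sub>C T s"
proof -
  have "H i c * T s - T s * H i c = of_int (s $ i) *\<^sub>C E (tmon s \<otimes>\<^sub>C c)"
    unfolding H_def T_def E_pure_bracket lie_bracket_hamd_tmon E_pure_scale by simp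
  then show ?thesis by (cases "s = 0") (simp_all add: E_tmon scaleC_scaleC)
qed

lemma T_T: "T r * T s = T s * T r"
  unfolding T_def by (rule tmon_tmon_commute)

lemma X_X: "X r b * X s c - X s c * X r b = of_int (symp r s) *\<^sub>C X (r + s) (b * c)"
  unfolding X_def E_pure_bracket lie_bracket_hamD_hamD pairing_eq_symp E_pure_scale ..

lemma H_X: "H i c * X s b - X s b * H i c = of_int (s $ i) *\<^sub>C X s (c * b)"
  unfolding X_def H_def E_pure_bracket lie_bracket_hamd_hamD E_pure_scale ..

lemma H_H: "H i b * H j c = H j c * H i b"
  using E_pure_bracket[of "hamd i" b "hamd j" c]
  unfolding H_def by (simp add: lie_bracket_hamd_hamd tensor_0_left E_0)

lemma X_scale: "X s (c *\<^sub>C b) = c *\<^sub>C X s b"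
  unfolding X_def by (simp add: tensor_scaleC_right E_scale)

lemma X_add: "X s (b + c) = X s b + X s c"
  unfolding X_def by (simp add: tensor_add_right E_add)

lemma X_0: "X 0 b = 0"
  unfolding X_def by (simp add: hamD_0 tensor_0_left E_0)

lemma invariant_subspace:
  assumes W: "cvec.subspace W" and v: "v \<in> W" "v \<noteq> 0"
    and stable: "\<And>r b w. w \<in> W \<Longrightarrow> app (X r b) w \<in> W" "\<And>i b w. w \<in> W \<Longrightarrow> app (H i b) w \<in> W"
      "\<And>r b w. w \<in> W \<Longrightarrow> app (E (tmon r \<otimes>\<^sub>C b)) w \<in> W"
  shows "w \<in> W"
proof -
  have "x \<in> {x. \<forall>w\<in>W. app (E x) w \<in> W}" for x
  proof (rule tensor_generators)
    show "cvec.subspace {x. \<forall>w\<in>W. app (E x) w \<in> W}"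
      using W by (simp add: cvec.subspace_def E_add E_scale E_0 del: app_E)
  qed (use stable in \<open>simp_all add: X_def H_def\<close>)
  then have "\<forall>x. \<forall>w\<in>W. \<rho> x w \<in> W" by simp
  then have "W = {0} \<or> W = UNIV" using irr W unfolding irreducible_lie_module_def by blast
  then show ?thesis using v by blast
qed

section \<open>Weight spaces\<close>

text \<open>The weight space on which \<open>d\<^sub>i\<close> acts by \<open>c i\<close>. Weights are recorded by their values on the
  basis of the Cartan subalgebra, so that shifting them by lattice vectors is immediate.\<close>

definition wt :: "('m + 'm \<Rightarrow> complex) \<Rightarrow> 'v set"
  where "wt c = {v. \<forall>i. app (H i 1) v = c i *\<^sub>C v}"

text \<open>\<open>deg \<gamma> f\<close>: the operator \<open>f\<close> shifts weights by \<open>\<gamma>\<close>.\<close>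

definition deg :: "int ^ ('m + 'm) \<Rightarrow> 'v endo \<Rightarrow> bool"
  where "deg \<gamma> f \<longleftrightarrow> (\<forall>i. H i 1 * f - f * H i 1 = of_int (\<gamma> $ i) *\<^sub>C f)"

lemma deg_mult: "deg \<gamma> f \<Longrightarrow> deg \<delta> g \<Longrightarrow> deg (\<gamma> + \<delta>) (f * g)"
  unfolding deg_def by (simp add: commutator_mult scaleC_add_left)

lemma deg_scale: "deg \<gamma> f \<Longrightarrow> deg \<gamma> (c *\<^sub>C f)"
  unfolding deg_def
  by (simp add: cvec.scale_right_diff_distrib[symmetric] scaleC_scaleC mult.commute)

lemma deg_T: "deg s (T s)"
  unfolding deg_def by (simp add: H_T)

lemma deg_X: "deg s (X s b)"
  unfolding deg_def by (simp add: H_X)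

lemma deg_H: "deg 0 (H i b)"
  unfolding deg_def by (simp add: H_H)

lemma deg_0_wt:
  assumes "deg 0 f" "v \<in> wt c"
  shows "app f v \<in> wt c"
proof -
  have "app (H i 1) (app f v) = c i *\<^sub>C app f v" for i
  proof -
    have "H i 1 * f - f * H i 1 = 0" using assms(1) unfolding deg_def by simp
    then have "app (H i 1 * f - f * H i 1) v = 0" by simp
    then show ?thesis using assms(2) unfolding wt_def by simp
  qed
  then show ?thesis unfolding wt_def by simp
qed

lemma wt_weight_space:
  assumes "\<mu> \<in> dual_space cartan"
  shows "weight_space \<rho> \<mu> \<subseteq> wt (\<lambda>i. \<mu> (hamd i))"
  unfolding weight_space_def wt_def H_def cartan_def by (auto intro: cvec.span_base)

text \<open>A nonzero weight vector determines a functional on the Cartan subalgebra, so that linear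
  independence of the \<open>d\<^sub>i\<close> need not be discussed.\<close>

lemma wt_subset_weight_space:
  assumes v: "v \<in> wt c" "v \<noteq> 0"
  obtains \<mu> where "\<mu> \<in> dual_space cartan" "wt c \<subseteq> weight_space \<rho> \<mu>"
proof -
  let ?P = "\<lambda>h e. \<forall>w\<in>wt c. app (E (h \<otimes>\<^sub>C 1)) w = e *\<^sub>C w"
  have Padd: "?P (h + h') (e + e')" if "?P h e" "?P h' e'" for h h' e e'
    using that by (simp add: tensor_add_left E_add scaleC_add_left del: app_E)
  have Pscale: "?P (a *\<^sub>C h) (a * e)" if "?P h e" for h e a
    using that by (simp add: E_pure_scale scaleC_scaleC del: app_E)
  have uniq: "e = e'" if "?P h e" "?P h e'" for h e e'
  proof -
    have "e *\<^sub>C v = e' *\<^sub>C v" using that v by metis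
    then show ?thesis using v(2) by simp
  qed
  have "cvec.subspace {h. \<exists>e. ?P h e}"
    unfolding cvec.subspace_def
  proof (intro conjI ballI allI)
    show "0 \<in> {h. \<exists>e. ?P h e}" by (auto simp: tensor_0_left E_0 simp del: app_E intro!: exI[of _ 0])
  qed (use Padd Pscale in blast)+
  moreover have "hamd i \<in> {h. \<exists>e. ?P h e}" for i
    unfolding wt_def H_def by auto
  then have "range hamd \<subseteq> {h. \<exists>e. ?P h e}" by (rule image_subsetI)
  ultimately have sub: "cartan \<subseteq> {h. \<exists>e. ?P h e}"
    unfolding cartan_def by (intro cvec.span_minimal)
  have ex: "\<exists>e. ?P h e" if "h \<in> cartan" for h
    using subsetD[OF sub that] by simp
  define \<mu> where "\<mu> = restrict (\<lambda>h. SOME e. ?P h e) cartan"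
  have mu: "?P h (\<mu> h)" if "h \<in> cartan" for h
  proof -
    have "\<mu> h = (SOME e. ?P h e)" using that unfolding \<mu>_def by (rule restrict_apply')
    then show ?thesis by (simp only:) (rule someI_ex[OF ex[OF that]])
  qed
  have cs: "cvec.subspace cartan" unfolding cartan_def by (rule cvec.subspace_span)
  have "\<mu> \<in> dual_space cartan"
    unfolding dual_space_def
  proof (intro CollectI conjI ballI allI)
    show "\<mu> \<in> extensional cartan" unfolding \<mu>_def by simp
  next
    fix x y :: "'m ham_laurent" assume xy: "x \<in> cartan" "y \<in> cartan"
    show "\<mu> (x + y) = \<mu> x + \<mu> y"
      by (rule uniq[OF mu[OF cvec.subspace_add[OF cs xy]] Padd[OF mu[OF xy(1)] mu[OF xy(2)]]])
  next
    fix a and x :: "'m ham_laurent" assume x: "x \<in> cartan"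
    show "\<mu> (a *\<^sub>C x) = a * \<mu> x"
      by (rule uniq[OF mu[OF cvec.subspace_scale[OF cs x]] Pscale[OF mu[OF x]]])
  qed
  moreover have "wt c \<subseteq> weight_space \<rho> \<mu>" using mu unfolding weight_space_def by auto
  ultimately show ?thesis by (rule that)
qed

lemma wt_bounded: "\<exists>M. \<forall>c. dim_at_most M (wt c)"
proof -
  obtain M where M: "\<And>\<mu>. \<mu> \<in> dual_space cartan \<Longrightarrow>
      (\<exists>S. finite S \<and> cvec.span S = weight_space \<rho> \<mu>) \<and> cvec.dim (weight_space \<rho> \<mu>) \<le> M"
    using HC unfolding uniformly_bounded_HC_module_def by blast
  have "dim_at_most M (wt c)" for c
  proof (cases "wt c \<subseteq> {0}")
    case True
    then show ?thesis unfolding dim_at_most_def by (intro exI[of _ "{}"]) simp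
  next
    case False
    then obtain v where "v \<in> wt c" "v \<noteq> 0" by blast
    then obtain \<mu> where mu: "\<mu> \<in> dual_space cartan" "wt c \<subseteq> weight_space \<rho> \<mu>"
      using wt_subset_weight_space by blast
    obtain B where B: "B \<subseteq> weight_space \<rho> \<mu>" "cvec.independent B"
      "weight_space \<rho> \<mu> \<subseteq> cvec.span B" "card B = cvec.dim (weight_space \<rho> \<mu>)"
      by (rule cvec.basis_exists)
    obtain S where S: "finite S" "cvec.span S = weight_space \<rho> \<mu>" using M[OF mu(1)] by blast
    have "finite B" using cvec.independent_span_bound[OF S(1) B(2)] B(1) S(2) by simp
    moreover have "card B \<le> M" using B(4) M[OF mu(1)] by simp
    ultimately show ?thesis
      unfolding dim_at_most_def using order_trans[OF mu(2) B(3)] by blast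
  qed
  then show ?thesis by blast
qed

lemma zero_on_weight_spaces:
  assumes "\<And>c v. v \<in> wt c \<Longrightarrow> app f v = 0"
  shows "f = 0"
proof (rule endo_eqI)
  fix v
  have "is_direct_sum (dual_space cartan) (weight_space \<rho>)"
    using HC unfolding uniformly_bounded_HC_module_def by blast
  then obtain g where g: "\<forall>i\<in>dual_space cartan. g i \<in> weight_space \<rho> i" "\<forall>i. i \<notin> dual_space cartan \<longrightarrow> g i = 0"
    "v = (\<Sum>i | g i \<noteq> 0. g i)" unfolding is_direct_sum_def by metis
  have "app f (g i) = 0" if "g i \<noteq> 0" for i
  proof -
    have "i \<in> dual_space cartan" using that g(2) by blast
    then have "g i \<in> wt (\<lambda>j. i (hamd j))" using wt_weight_space g(1) by blast
    then show ?thesis by (rule assms)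
  qed
  moreover have "app f (\<Sum>i\<in>A. g i) = (\<Sum>i\<in>A. app f (g i))" for A
    by (rule clinear_sum) (use app[of f] in simp)
  ultimately have "app f (\<Sum>i | g i \<noteq> 0. g i) = 0" by simp
  then show "app f v = app 0 v" using g(3) by simp
qed

section \<open>The commutative algebra generated by the monomials\<close>

text \<open>The unit is not adjoined to this algebra.\<close>

inductive_set P :: "'v endo set" where
  P_T: "T s \<in> P"
| P_0: "0 \<in> P"
| P_add: "f \<in> P \<Longrightarrow> g \<in> P \<Longrightarrow> f + g \<in> P"
| P_mult: "f \<in> P \<Longrightarrow> g \<in> P \<Longrightarrow> f * g \<in> P"
| P_scale: "f \<in> P \<Longrightarrow> a *\<^sub>C f \<in> P"

lemma centralizes_P:
  assumes "\<And>s. y * T s = T s * y" "f \<in> P"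
  shows "y * f = f * y"
  using assms(2)
proof induction
  case (P_mult f g)
  then show ?case by (metis mult.assoc)
qed (simp_all add: assms(1) distrib_left distrib_right)

lemma P_commute: "f \<in> P \<Longrightarrow> g \<in> P \<Longrightarrow> f * g = g * f"
  by (rule centralizes_P) (simp_all add: centralizes_P T_T)

lemma bracket_P:
  assumes "\<And>s. y * T s - T s * y \<in> P" "f \<in> P"
  shows "y * f - f * y \<in> P"
  using assms(2)
proof induction
  case (P_add f g)
  have "y * (f + g) - (f + g) * y = (y * f - f * y) + (y * g - g * y)" by (simp add: algebra_simps)
  then show ?case using P_add P.P_add by simp
next
  case (P_scale f a)
  have "y * (a *\<^sub>C f) - (a *\<^sub>C f) * y = a *\<^sub>C (y * f - f * y)"
    by (simp add: cvec.scale_right_diff_distrib)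
  then show ?case using P_scale P.P_scale by simp
next
  case (P_mult f g)
  then show ?case unfolding commutator_mult by (intro P.P_add P.P_mult)
qed (simp_all add: assms(1) P.P_0)

lemma X_P: "f \<in> P \<Longrightarrow> X q c * f - f * X q c \<in> P"
  by (rule bracket_P) (simp_all add: X_T P_scale P_T)

lemma H_P: "f \<in> P \<Longrightarrow> H i c * f - f * H i c \<in> P"
  by (rule bracket_P) (simp_all add: H_T P_scale P_T)

lemma tmon_P: "f \<in> P \<Longrightarrow> E (tmon r \<otimes>\<^sub>C c) * f - f * E (tmon r \<otimes>\<^sub>C c) \<in> P"
  by (rule bracket_P) (simp_all add: T_def tmon_tmon_commute P_0)

text \<open>An element of \<open>P\<close> acts injectively or locally nilpotently.\<close>

lemma P_locally_nilpotent:
  assumes f: "f \<in> P" and v: "app f v = 0" "v \<noteq> 0"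
  shows "\<exists>k. app (f ^ k) w = 0"
proof -
  let ?W = "{w. \<exists>k. app (f ^ k) w = 0}"
  have "cvec.subspace ?W"
    unfolding cvec.subspace_def
  proof (intro conjI ballI allI)
    show "0 \<in> ?W" by simp
  next
    fix x y assume "x \<in> ?W" "y \<in> ?W"
    then obtain k l where "app (f ^ k) x = 0" "app (f ^ l) y = 0" by blast
    then have "app (f ^ max k l) (x + y) = 0"
      using app_power_0_mono[of f k x "max k l"] app_power_0_mono[of f l y "max k l"] by simp
    then show "x + y \<in> ?W" by blast
  next
    fix c x assume "x \<in> ?W"
    then show "c *\<^sub>C x \<in> ?W" by auto
  qed
  moreover have "v \<in> ?W" using v by (auto intro!: exI[of _ 1])
  moreover have stable: "app y w \<in> ?W" if y: "y * f - f * y \<in> P" and w: "w \<in> ?W" for y w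
  proof -
    obtain k where k: "app (f ^ k) w = 0" using w by blast
    have D: "f * (y * f - f * y) = (y * f - f * y) * f" by (rule P_commute[OF f y])
    have "y * f ^ Suc k - f ^ Suc k * y = of_nat (Suc k) *\<^sub>C ((y * f - f * y) * f ^ k)"
      unfolding commutator_power[OF refl D] commute_power[OF D] ..
    then have "app (y * f ^ Suc k - f ^ Suc k * y) w
        = app (of_nat (Suc k) *\<^sub>C ((y * f - f * y) * f ^ k)) w" by simp
    then have "app y (app f (app (f ^ k) w)) - app (f ^ Suc k) (app y w)
        = of_nat (Suc k) *\<^sub>C app (y * f - f * y) (app (f ^ k) w)" by simp
    then have "app (f ^ Suc k) (app y w) = 0" unfolding k by simp
    then show ?thesis by blast
  qed
  ultimately have "w \<in> ?W"
    using invariant_subspace[of ?W v w] v(2) stable[OF X_P[OF f]] stable[OF H_P[OF f]]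
      stable[OF tmon_P[OF f]] by blast
  then show ?thesis by blast
qed

text \<open>The nilradical of \<open>P\<close>.\<close>

definition N :: "'v endo set"
  where "N = {f \<in> P. \<exists>k. f ^ k = 0}"

text \<open>For operators of weight \<open>0\<close> the uniform bound on the weight spaces bounds the exponent.\<close>

lemma P_noninjective_nilpotent:
  assumes f: "f \<in> P" "deg 0 f" and v: "app f v = 0" "v \<noteq> 0"
  shows "f \<in> N"
proof -
  obtain M where M: "\<And>c. dim_at_most M (wt c)" using wt_bounded by blast
  have "f ^ M = 0"
  proof (rule zero_on_weight_spaces)
    fix c w assume w: "w \<in> wt c"
    obtain k where "app (f ^ k) w = 0" using P_locally_nilpotent[OF f(1) v] by blast
    from nilpotent_on_bound[OF M deg_0_wt[OF f(2)] w this] show "app (f ^ M) w = 0" .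
  qed
  then show ?thesis using f unfolding N_def by blast
qed

lemma N_add: "f \<in> N \<Longrightarrow> g \<in> N \<Longrightarrow> f + g \<in> N"
  unfolding N_def using nilpotent_add P_commute P_add by blast

lemma N_mult: assumes "f \<in> P" "g \<in> N" shows "f * g \<in> N"
proof -
  obtain k where k: "g ^ k = 0" "g \<in> P" using assms(2) unfolding N_def by blast
  then have "(f * g) ^ k = 0" using power_mult_commuting[OF P_commute[OF assms(1) k(2)]] by simp
  then show ?thesis unfolding N_def using P_mult[OF assms(1) k(2)] by blast
qed

lemma N_diff: "f \<in> N \<Longrightarrow> g \<in> N \<Longrightarrow> f - g \<in> N"
proof -
  assume f: "f \<in> N" and g: "g \<in> N"
  then obtain k where "g ^ k = 0" unfolding N_def by blast
  then have "((-1) *\<^sub>C g) ^ k = 0"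
    using power_mult_commuting[of "(-1) *\<^sub>C 1" g k] by simp
  then have "(-1) *\<^sub>C g \<in> N" using g P_scale unfolding N_def by blast
  from N_add[OF f this] show ?thesis by simp
qed

lemma N_scale_iff: "a \<noteq> 0 \<Longrightarrow> a *\<^sub>C f \<in> N \<Longrightarrow> f \<in> N"
proof -
  assume a: "a \<noteq> 0" and N: "a *\<^sub>C f \<in> N"
  then obtain k where k: "(a *\<^sub>C f) ^ k = 0" "a *\<^sub>C f \<in> P" unfolding N_def by blast
  have f: "inverse a *\<^sub>C 1 * (a *\<^sub>C f) = f" using a by simp
  have "(inverse a *\<^sub>C 1 * (a *\<^sub>C f)) ^ k = (inverse a *\<^sub>C 1) ^ k * (a *\<^sub>C f) ^ k"
    by (rule power_mult_commuting) simp
  then have "f ^ k = 0" unfolding f k by simp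
  moreover have "f \<in> P" using P_scale[OF k(2), of "inverse a"] a by simp
  ultimately show ?thesis unfolding N_def by blast
qed

lemma N_square: "f \<in> P \<Longrightarrow> f * f \<in> N \<Longrightarrow> f \<in> N"
  unfolding N_def by (auto simp: power2_eq_square[symmetric] power_mult[symmetric])

lemma N_X: assumes f: "f \<in> N" shows "X q c * f - f * X q c \<in> N"
proof -
  obtain k where k: "f ^ k = 0" "f \<in> P" using f unfolding N_def by blast
  let ?D = "X q c * f - f * X q c"
  have D: "?D \<in> P" using X_P k(2) by blast
  have "?D ^ (2 * k) = 0"
    by (rule nilpotent_derivation[OF refl refl P_commute[OF k(2) D] P_commute[OF D X_P[OF D]] k(1)])
  then show ?thesis using D unfolding N_def by blast
qed

section \<open>The monomials act injectively\<close>

text \<open>In the successive steps \<open>T r T p\<close> is shown to lie in \<open>N\<close> first for \<open>symp p r \<noteq> 0\<close>, then for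
  all \<open>p \<noteq> 0\<close>, in particular for \<open>p = r\<close>.\<close>

lemma T_T_neg_nilpotent:
  assumes r: "r \<noteq> 0" and F: "T r * T (- r) \<in> N" and b: "b \<noteq> 0"
  shows "T b \<in> N"
proof -
  have PT: "T a * T c \<in> P" for a c by (intro P_mult P_T)
  have br: "of_int (symp a r') *\<^sub>C (T (a + r') * T p) + of_int (symp a p) *\<^sub>C (T r' * T (a + p)) \<in> N"
    if "T r' * T p \<in> N" for a r' p
    using N_X[OF that, of a 1] by (simp add: commutator_mult X_T)
  have 1: "T r * T p \<in> N" if p: "symp p r \<noteq> 0" for p
  proof -
    let ?c = "of_int (symp p r) :: complex"
    have "?c *\<^sub>C (T (p + r + r) * T (- r)) - ?c *\<^sub>C (T r * T p) \<in> N"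
      using br[OF F, of "p + r"] by simp
    then have "T r * (?c *\<^sub>C (T (p + r + r) * T (- r)) - ?c *\<^sub>C (T r * T p)) \<in> N"
      by (rule N_mult[OF P_T])
    \<comment> \<open>The first summand is a multiple of \<open>T r * T (- r)\<close> and can be subtracted.\<close>
    moreover have "?c *\<^sub>C (T (p + r + r) * (T r * T (- r))) \<in> N"
      using N_mult[OF P_scale[OF P_T, of ?c "p + r + r"] F] by simp
    moreover have "T r * (T (p + r + r) * T (- r)) = T (p + r + r) * (T r * T (- r))"
      by (simp only: mult.assoc[symmetric] T_T[of r "p + r + r"])
    ultimately have "?c *\<^sub>C (T (p + r + r) * (T r * T (- r)))
        - T r * (?c *\<^sub>C (T (p + r + r) * T (- r)) - ?c *\<^sub>C (T r * T p)) \<in> N"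
      by (intro N_diff)
    then have "?c *\<^sub>C (T r * (T r * T p)) \<in> N"
      using \<open>T r * (T (p + r + r) * T (- r)) = _\<close> by (simp add: right_diff_distrib)
    then have "T r * (T r * T p) \<in> N" by (rule N_scale_iff[rotated]) (simp add: p)
    then have "T p * (T r * (T r * T p)) \<in> N" by (rule N_mult[OF P_T])
    moreover have "T p * (T r * (T r * T p)) = T r * T p * (T r * T p)"
      by (simp only: mult.assoc[symmetric] T_T[of p])
    ultimately show ?thesis using N_square[OF PT] by simp
  qed
  have 2: "T r * T b \<in> N" if b: "b \<noteq> 0" for b
  proof -
    obtain p where p: "symp p r \<noteq> 0" "symp p b \<noteq> 0" using symp_avoid_two[OF r b] .
    let ?a = "b - p"
    let ?x = "of_int (symp ?a r) :: complex" and ?y = "of_int (symp ?a p) :: complex"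
    have y: "?y \<noteq> 0" using p(2) symp_antisym[of p b] by simp
    have N: "T r * T p \<in> N" by (rule 1[OF p(1)])
    have "T r * (?x *\<^sub>C (T (?a + r) * T p) + ?y *\<^sub>C (T r * T b)) \<in> N"
      using N_mult[OF P_T br[OF N, of ?a]] by simp
    moreover have "?x *\<^sub>C (T (?a + r) * (T r * T p)) \<in> N"
      using N_mult[OF P_scale[OF P_T, of ?x "?a + r"] N] by simp
    moreover have eq: "T r * (T (?a + r) * T p) = T (?a + r) * (T r * T p)"
      by (simp only: mult.assoc[symmetric] T_T[of r "?a + r"])
    ultimately have "T r * (?x *\<^sub>C (T (?a + r) * T p) + ?y *\<^sub>C (T r * T b))
        - ?x *\<^sub>C (T (?a + r) * (T r * T p)) \<in> N" by (intro N_diff)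
    then have "?y *\<^sub>C (T r * (T r * T b)) \<in> N" using eq by (simp add: distrib_left)
    then have "T r * (T r * T b) \<in> N" using y by (rule N_scale_iff[rotated])
    then have "T b * (T r * (T r * T b)) \<in> N" by (rule N_mult[OF P_T])
    moreover have "T b * (T r * (T r * T b)) = T r * T b * (T r * T b)"
      by (simp only: mult.assoc[symmetric] T_T[of b])
    ultimately show ?thesis using N_square[OF PT] by simp
  qed
  have Tr: "T r \<in> N" by (rule N_square[OF P_T 2[OF r]])
  have step: "T b \<in> N" if "T p \<in> N" "symp b p \<noteq> 0" for b p
  proof -
    have "of_int (symp b p) *\<^sub>C T b \<in> N" using N_X[OF that(1), of "b - p" 1] by (simp add: X_T)
    then show ?thesis by (rule N_scale_iff[rotated]) (simp add: that(2))
  qed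
  obtain p where p: "symp p r \<noteq> 0" "symp p b \<noteq> 0" using symp_avoid_two[OF r b] .
  have "symp b p \<noteq> 0" using p(2) symp_antisym[of b p] by simp
  then show ?thesis by (rule step[OF step[OF Tr p(1)]])
qed

text \<open>Differentiating \<open>T r ^ k = 0\<close> repeatedly turns the factors \<open>T r\<close> into arbitrary monomials from
  the open half space \<open>symp _ r > 0\<close>, which the brackets do not leave.\<close>

lemma half_space_products:
  assumes r: "T r ^ k = 0" and as: "length as \<le> k" "\<And>a. a \<in> set as \<Longrightarrow> 0 < symp a r"
  shows "prod_list (map T as) * T r ^ (k - length as) = 0"
  using as
proof (induction "length as" arbitrary: as)
  case 0
  then show ?case using r by simp
next
  case (Suc n)
  then obtain c as' where as: "as = c # as'" and n: "n = length as'" by (cases as) auto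
  define m where "m = k - Suc n"
  have km: "k - n = Suc m" using Suc.prems(1) Suc.hyps(2) unfolding m_def by simp
  have c: "0 < symp c r" using Suc.prems(2) as by simp
  have pos: "0 < symp a r" if "a \<in> set as'" for a using Suc.prems(2) as that by simp
  have IH: "prod_list (map T bs) * T r ^ Suc m = 0"
    if "length bs = n" "\<And>a. a \<in> set bs \<Longrightarrow> 0 < symp a r" for bs
    using Suc.hyps(1)[of bs] that km Suc.prems(1) Suc.hyps(2) by simp
  \<comment> \<open>The bracket with \<open>?Y\<close> turns a factor \<open>T r\<close> into a multiple of \<open>T c\<close>; on the other factors it
    only shifts the exponents inside the half space, and these terms vanish by induction.\<close>
  let ?Y = "X (c - r) 1"
  have inner: "prod_list (map T pre) * (?Y * prod_list (map T suf) - prod_list (map T suf) * ?Y) * T r ^ Suc m = 0"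
    if "length pre + length suf = n" "\<And>a. a \<in> set pre \<union> set suf \<Longrightarrow> 0 < symp a r" for pre suf
    using that
  proof (induction suf arbitrary: pre)
    case Nil
    then show ?case by simp
  next
    case (Cons a suf)
    have 1: "prod_list (map T (pre @ (c - r + a) # suf)) * T r ^ Suc m = 0"
      by (rule IH) (use Cons.prems c in \<open>auto simp: add_pos_pos\<close>)
    have 2: "prod_list (map T (pre @ [a])) * (?Y * prod_list (map T suf) - prod_list (map T suf) * ?Y) * T r ^ Suc m = 0"
      by (rule Cons.IH) (use Cons.prems in auto)
    have "prod_list (map T pre) * (?Y * prod_list (map T (a # suf)) - prod_list (map T (a # suf)) * ?Y) * T r ^ Suc m
      = of_int (symp (c - r) a) *\<^sub>C (prod_list (map T (pre @ (c - r + a) # suf)) * T r ^ Suc m)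
        + prod_list (map T (pre @ [a])) * (?Y * prod_list (map T suf) - prod_list (map T suf) * ?Y) * T r ^ Suc m"
      unfolding prod_list.Cons list.map commutator_mult X_T
      by (simp add: distrib_left distrib_right mult.assoc)
    then show ?case unfolding 1 2 by simp
  qed
  let ?S = "prod_list (map T as')"
  have z: "?S * T r ^ Suc m = 0" by (rule IH) (use n pos in auto)
  have "0 = ?Y * (?S * T r ^ Suc m) - ?S * T r ^ Suc m * ?Y" unfolding z by simp
  also have "\<dots> = (?Y * ?S - ?S * ?Y) * T r ^ Suc m + ?S * (?Y * T r ^ Suc m - T r ^ Suc m * ?Y)"
    by (rule commutator_mult)
  also have "(?Y * ?S - ?S * ?Y) * T r ^ Suc m = 0" using inner[of "[]" as'] n pos by simp
  also have "?Y * T r ^ Suc m - T r ^ Suc m * ?Y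
      = of_nat (Suc m) *\<^sub>C (T r ^ m * (of_int (symp c r) *\<^sub>C T c))"
    by (rule commutator_power) (simp_all add: X_T T_T)
  finally have "(of_nat (Suc m) * of_int (symp c r)) *\<^sub>C (?S * (T r ^ m * T c)) = 0"
    by (simp only: endo_scaleC scaleC_scaleC add_0_left)
  then have "?S * (T r ^ m * T c) = 0"
    using c by (metis cvec.scale_eq_0_iff mult_eq_0_iff of_int_eq_0_iff of_nat_neq_0 order_less_irrefl)
  moreover have "?S * (T r ^ m * T c) = T c * ?S * T r ^ m"
  proof -
    have "?S \<in> P" if "as' \<noteq> []" using that
      by (induction as' rule: list_nonempty_induct) (auto intro: P_T P_mult)
    then have Sc: "?S * T c = T c * ?S" by (cases "as' = []") (auto intro: P_commute P_T)
    have "?S * (T r ^ m * T c) = ?S * T c * T r ^ m"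
      by (simp only: commute_power[OF T_T] mult.assoc)
    then show ?thesis unfolding Sc .
  qed
  ultimately show ?case using n by (simp add: as m_def)
qed

text \<open>For each \<open>r\<close> in turn, a longest nonvanishing product of monomials from the half space of \<open>r\<close>
  moves the vector into the kernel of that half space.\<close>

lemma common_half_space_kernel:
  assumes "finite R" and nil: "\<And>r. r \<in> R \<Longrightarrow> \<exists>k. T r ^ k = 0"
  shows "\<exists>v. v \<noteq> 0 \<and> (\<forall>r\<in>R. \<forall>a. 0 < symp a r \<longrightarrow> app (T a) v = 0)"
  using assms
proof (induction R)
  case empty
  have "(UNIV :: 'v set) \<noteq> {0}" using irr unfolding irreducible_lie_module_def by blast
  then show ?case by auto
next
  case (insert r R)
  then obtain v where v: "v \<noteq> 0" "\<And>r a. r \<in> R \<Longrightarrow> 0 < symp a r \<Longrightarrow> app (T a) v = 0" by auto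
  obtain k where k: "T r ^ k = 0" using insert.prems by blast
  let ?S = "T ` {a. 0 < symp a r}"
  have kills: "kills {v} k ?S"
    unfolding kills_def
  proof (intro allI impI ballI)
    fix xs u assume xs: "set xs \<subseteq> ?S \<and> length xs = k"
    then have "xs \<in> lists (T ` {a. 0 < symp a r})" by (auto simp: lists_eq_set)
    then obtain as where as: "xs = map T as" "set as \<subseteq> {a. 0 < symp a r}"
      unfolding lists_image by (auto simp: lists_eq_set)
    then have "prod_list xs * T r ^ (k - length as) = 0"
      using half_space_products[OF k, of as] xs by auto
    then have "prod_list xs = 0" using as xs by simp
    then show "app (prod_list xs) u = 0" by simp
  qed
  obtain ys where ys: "set ys \<subseteq> ?S" "app (prod_list ys) v \<noteq> 0"
    "\<And>zs. set zs \<subseteq> ?S \<Longrightarrow> length ys < length zs \<Longrightarrow> app (prod_list zs) v = 0"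
    using longest_nonvanishing_product[OF kills, of v] v(1) by blast
  have "app (T a) (app (prod_list ys) v) = 0" if "0 < symp a r" for a
    using ys(3)[of "T a # ys"] ys(1) that by simp
  moreover have "app (T a) (app (prod_list ys) v) = 0" if "r' \<in> R" "0 < symp a r'" for r' a
  proof -
    have "T a * prod_list zs = prod_list zs * T a" if "set zs \<subseteq> ?S" for zs
      using that
    proof (induction zs)
      case (Cons z zs)
      then have z: "T a * z = z * T a" and IH: "T a * prod_list zs = prod_list zs * T a"
        using T_T by auto
      have "T a * prod_list (z # zs) = z * (T a * prod_list zs)"
        by (simp add: mult.assoc[symmetric] z)
      then show ?case by (simp add: IH mult.assoc)
    qed simp
    then have "app (T a * prod_list ys) v = app (prod_list ys * T a) v" using ys(1) by metis
    then show ?thesis using v(2)[OF that] by simp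
  qed
  ultimately show ?case using ys(2) by (intro exI[of _ "app (prod_list ys) v"]) auto
qed

lemma not_all_T_nilpotent: "\<exists>r. r \<noteq> 0 \<and> T r \<notin> N"
proof (rule ccontr)
  assume "\<not> ?thesis"
  then have nil: "\<exists>k. T r ^ k = 0" if "r \<noteq> 0" for r using that unfolding N_def by blast
  let ?R = "range (\<lambda>i. axis i 1) \<union> range (\<lambda>i. - axis i 1) :: (int ^ ('m + 'm)) set"
  have ax: "axis i (1::int) \<noteq> 0" for i :: "'m + 'm" by (simp add: axis_eq_0_iff)
  have "finite ?R" by simp
  moreover have "\<exists>k. T r ^ k = 0" if "r \<in> ?R" for r using that ax by (intro nil) auto
  ultimately obtain v where v: "v \<noteq> 0" "\<forall>r\<in>?R. \<forall>a. 0 < symp a r \<longrightarrow> app (T a) v = 0"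
    using common_half_space_kernel[of ?R] by blast
  let ?W = "{v. \<forall>a. a \<noteq> 0 \<longrightarrow> app (T a) v = 0}"
  have "app (T a) v = 0" if "a \<noteq> 0" for a
  proof -
    obtain i where "symp a (axis i 1) \<noteq> 0" using symp_axis_nonzero[OF \<open>a \<noteq> 0\<close>] .
    then consider "0 < symp a (axis i 1)" | "0 < symp a (- axis i 1)" by fastforce
    then show ?thesis using v(2) by cases blast+
  qed
  then have vW: "v \<in> ?W" by blast
  have sub: "cvec.subspace ?W" by (simp add: cvec.subspace_def)
  have stable: "app y w \<in> ?W"
    if y: "\<And>a. a \<noteq> 0 \<Longrightarrow> \<exists>c b. (b \<noteq> 0 \<or> c = 0) \<and> y * T a - T a * y = c *\<^sub>C T b" and w: "w \<in> ?W" for y w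
  proof -
    have "app (T a) (app y w) = 0" if a: "a \<noteq> 0" for a
    proof -
      obtain c b where cb: "b \<noteq> 0 \<or> c = 0" "y * T a - T a * y = c *\<^sub>C T b" using y[OF a] by blast
      have "app (y * T a - T a * y) w = c *\<^sub>C app (T b) w" unfolding cb(2) by simp
      then show ?thesis using w a cb(1) by auto
    qed
    then show ?thesis by blast
  qed
  have "w \<in> ?W" for w
  proof (rule invariant_subspace[OF sub vW v(1)])
    fix r b w assume w: "w \<in> ?W"
    show "app (X r b) w \<in> ?W"
    proof (rule stable[OF _ w])
      fix a :: "int ^ ('m + 'm)" assume "a \<noteq> 0"
      show "\<exists>c ba. (ba \<noteq> 0 \<or> c = 0) \<and> X r b * T a - T a * X r b = c *\<^sub>C T ba"
        unfolding X_T using symp_eq_0_if_sum_0[of r a] by fastforce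
    qed
    show "app (E (tmon r \<otimes>\<^sub>C b)) w \<in> ?W"
      by (rule stable[OF _ w]) (auto simp: T_def tmon_tmon_commute[of r b] intro!: exI[of _ 0])
  next
    fix i b w assume w: "w \<in> ?W"
    show "app (H i b) w \<in> ?W" by (rule stable[OF _ w]) (auto simp: H_T)
  qed
  then have "app (T a) w = 0" if "a \<noteq> 0" for a w using that by blast
  then show False using nontrivial by (auto simp: T_def)
qed

lemma T_injective:
  assumes r: "r \<noteq> 0" and v: "app (T r) v = 0"
  shows "v = 0"
proof (rule ccontr)
  assume "v \<noteq> 0"
  have "deg 0 (T r * T (- r))" using deg_mult[OF deg_T deg_T, of r "- r"] by simp
  moreover have "app (T r * T (- r)) v = 0" using v by (simp add: T_T[of r]) 
  ultimately have "T r * T (- r) \<in> N"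
    using \<open>v \<noteq> 0\<close> by (intro P_noninjective_nilpotent[of _ v]) (auto intro: P_T P_mult)
  then show False using T_T_neg_nilpotent[OF r] not_all_T_nilpotent by blast
qed

section \<open>The ideal generated by the kernel of \<open>\<psi>\<close>\<close>

lemma X_commute_T: "\<psi> b = 0 \<Longrightarrow> X s b * T r = T r * X s b"
  using X_T[of s b r] by simp

lemma X_commute_P: "\<psi> b = 0 \<Longrightarrow> f \<in> P \<Longrightarrow> X s b * f = f * X s b"
  by (rule centralizes_P) (rule X_commute_T)

lemma X_commute_X: "X s b * X s c = X s c * X s b"
  using X_X[of s b s c] by simp

text \<open>Jacobson's lemma is applied to \<open>A = H i b\<close> and \<open>B = T (- s) X s 1\<close>; the factor \<open>T (- s)\<close> brings
  the operators back to the same finite-dimensional weight space.\<close>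

lemma X_locally_nilpotent:
  assumes b: "\<psi> b = 0" and s: "s \<noteq> 0" and v: "v \<in> wt c"
  shows "\<exists>k. app (X s b ^ k) v = 0"
proof -
  obtain M where M: "\<And>c. dim_at_most M (wt c)" using wt_bounded by blast
  obtain i where i: "s $ i \<noteq> 0" using s by (auto simp: vec_eq_iff)
  let ?s = "of_int (s $ i) :: complex"
  let ?A = "H i b" and ?B = "T (- s) * X s 1" and ?C = "?s *\<^sub>C (T (- s) * X s b)"
    and ?D = "?s *\<^sub>C ?s *\<^sub>C (T (- s) * X s (b * b))"
  have AT: "?A * T (- s) - T (- s) * ?A = 0" using b by (simp add: H_T)
  have C: "?A * ?B - ?B * ?A = ?C"
    unfolding commutator_mult AT H_X by simp
  have D: "?A * ?C - ?C * ?A = ?D"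
  proof -
    have "?A * ?C - ?C * ?A = ?s *\<^sub>C (?A * (T (- s) * X s b) - (T (- s) * X s b) * ?A)"
      by (simp add: cvec.scale_right_diff_distrib)
    also have "\<dots> = ?D" unfolding commutator_mult AT H_X by simp
    finally show ?thesis .
  qed
  have XT: "X s c * T (- s) = T (- s) * X s c" for c using X_T[of s c "- s"] by simp
  have comm: "T (- s) * X s c * (T (- s) * X s d) = T (- s) * X s d * (T (- s) * X s c)" for c d
  proof -
    have merge: "T (- s) * X s c * (T (- s) * X s d) = T (- s) * (T (- s) * (X s c * X s d))" for c d
    proof -
      have "T (- s) * X s c * (T (- s) * X s d) = T (- s) * (X s c * T (- s)) * X s d"
        by (simp only: mult.assoc)
      then show ?thesis by (simp only: XT mult.assoc)
    qed
    show ?thesis unfolding merge X_commute_X[of s c d] ..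
  qed
  have BC: "?B * ?C = ?C * ?B" using comm by simp
  have CD: "?C * ?D = ?D * ?C" using comm[of b "b * b"] by simp
  have d0: "deg 0 (T (- s) * X s c)" for c using deg_mult[OF deg_T deg_X, of "- s" s c] by simp
  note pres = deg_0_wt[OF deg_H, of _ c i b] deg_0_wt[OF d0, of _ c 1]
    deg_0_wt[OF deg_scale[OF d0], of _ c ?s b]
    deg_0_wt[OF deg_scale[OF deg_scale[OF d0]], of _ c ?s ?s "b * b"]
  obtain k where "\<And>u. u \<in> wt c \<Longrightarrow> app (?C ^ k) u = 0"
    using nilpotent_commutator[OF M[of c] pres C BC D CD] by blast
  then have k: "app (?C ^ k) v = 0" using v by blast
  have pow: "?C ^ k = ?s ^ k *\<^sub>C (T (- s) ^ k * X s b ^ k)"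
  proof -
    have "(a *\<^sub>C f) ^ k = a ^ k *\<^sub>C f ^ k" for a and f :: "'v endo"
      by (induction k) simp_all
    then show ?thesis using power_mult_commuting[OF XT[symmetric]] by simp
  qed
  have "app (T (- s) ^ k) (app (X s b ^ k) v) = 0" using k i unfolding pow by simp
  moreover have "w = 0" if "app (T (- s) ^ k) w = 0" for w
    using that
  proof (induction k)
    case (Suc k)
    have "app (T (- s)) (app (T (- s) ^ k) w) = 0" using Suc.prems by simp
    then have "app (T (- s) ^ k) w = 0" by (rule T_injective[rotated]) (simp add: s)
    then show ?case by (rule Suc.IH)
  qed simp
  ultimately show ?thesis by blast
qed

lemma X_eq_0:
  assumes b: "\<psi> b = 0"
  shows "X s b = 0"
proof -
  have "\<exists>c u. u \<in> wt c \<and> u \<noteq> 0"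
  proof (rule ccontr)
    assume "\<not> ?thesis"
    then have "(1 :: 'v endo) = 0" by (intro zero_on_weight_spaces) auto
    then have "app 1 v = app 0 v" for v :: 'v by simp
    then have "v = 0" for v :: 'v by simp
    then show False using irr unfolding irreducible_lie_module_def by blast
  qed
  then obtain c u0 where u0: "u0 \<in> wt c" "u0 \<noteq> 0" by blast
  obtain M where M: "\<And>c. dim_at_most M (wt c)" using wt_bounded by blast
  \<comment> \<open>General \<open>f\<close>, not just monomials \<open>T (- s)\<close>, make this set closed under brackets.\<close>
  let ?W = "{f * X s b | f s b. f \<in> P \<and> deg (- s) f \<and> \<psi> b = 0}"
  obtain u where u: "u \<in> wt c" "u \<noteq> 0" "\<And>x. x \<in> ?W \<Longrightarrow> app x u = 0"
  proof (rule engel_bracket_closed[OF M[of c], of ?W u0])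
    fix x u assume "x \<in> ?W" "u \<in> wt c"
    then obtain f s b where x: "x = f * X s b" "f \<in> P" "deg (- s) f" "\<psi> b = 0" by blast
    have "deg 0 x" using deg_mult[OF x(3) deg_X, of s b] x(1) by simp
    then show "app x u \<in> wt c" using \<open>u \<in> wt c\<close> by (rule deg_0_wt)
    have fX: "f * X s b = X s b * f" using X_commute_P x by metis
    show "\<exists>k. app (x ^ k) u = 0"
    proof (cases "s = 0")
      case True
      then show ?thesis unfolding x by (intro exI[of _ 1]) (simp add: X_0)
    next
      case False
      obtain k where "app (X s b ^ k) u = 0"
        using X_locally_nilpotent[OF x(4) False \<open>u \<in> wt c\<close>] by blast
      then show ?thesis unfolding x power_mult_commuting[OF fX] by (intro exI[of _ k]) simp
    qed
  next
    fix x y assume "x \<in> ?W" "y \<in> ?W"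
    then obtain f s b g r b' where x: "x = f * X s b" "f \<in> P" "deg (- s) f" "\<psi> b = 0"
      and y: "y = g * X r b'" "g \<in> P" "deg (- r) g" "\<psi> b' = 0" by blast
    have "x * y = f * g * (X s b * X r b')"
      unfolding x y using X_commute_P[OF x(4) y(2), of s] by (metis mult.assoc)
    moreover have "y * x = f * g * (X r b' * X s b)"
      unfolding x y using X_commute_P[OF y(4) x(2), of r] P_commute[OF x(2) y(2)] by (metis mult.assoc)
    ultimately have "x * y - y * x = f * g * (X s b * X r b' - X r b' * X s b)"
      by (simp add: right_diff_distrib)
    also have "\<dots> = f * g * X (s + r) (of_int (symp s r) *\<^sub>C (b * b'))"
      unfolding X_X X_scale ..
    finally have "x * y - y * x = f * g * X (s + r) (of_int (symp s r) *\<^sub>C (b * b'))" .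
    moreover have "deg (- (s + r)) (f * g)" using deg_mult[OF x(3) y(3)] by simp
    moreover have "\<psi> (of_int (symp s r) *\<^sub>C (b * b')) = 0" using x(4) by simp
    ultimately show "x * y - y * x \<in> ?W" using P_mult[OF x(2) y(2)] by blast
  qed (use u0 in auto)
  let ?K = "{v. \<forall>s b. \<psi> b = 0 \<longrightarrow> app (X s b) v = 0}"
  have "app (X s b) u = 0" if "\<psi> b = 0" for s b
  proof (cases "s = 0")
    case True
    then show ?thesis by (simp add: X_0)
  next
    case False
    have "T (- s) * X s b \<in> ?W" using that deg_T[of "- s"] P_T by blast
    then have "app (T (- s) * X s b) u = 0" by (rule u(3))
    then have "app (T (- s)) (app (X s b) u) = 0" by simp
    then show ?thesis by (rule T_injective[rotated]) (simp add: False)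
  qed
  then have uK: "u \<in> ?K" by blast
  have sub: "cvec.subspace ?K" by (simp add: cvec.subspace_def)
  have stable: "app y w \<in> ?K"
    if y: "\<And>s b. \<psi> b = 0 \<Longrightarrow> \<exists>a r b'. \<psi> b' = 0 \<and> y * X s b - X s b * y = a *\<^sub>C X r b'"
      and w: "w \<in> ?K" for y w
  proof -
    have "app (X s b) (app y w) = 0" if b: "\<psi> b = 0" for s b
    proof -
      obtain a r b' where b': "\<psi> b' = 0" "y * X s b - X s b * y = a *\<^sub>C X r b'" using y[OF b] by blast
      have "app (y * X s b - X s b * y) w = a *\<^sub>C app (X r b') w" unfolding b'(2) by simp
      then show ?thesis using w b b'(1) by simp
    qed
    then show ?thesis by blast
  qed
  have K: "w \<in> ?K" for w
  proof (rule invariant_subspace[OF sub uK u(2)])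
    fix r d w assume w: "w \<in> ?K"
    show "app (X r d) w \<in> ?K"
    proof (rule stable[OF _ w])
      fix s b assume "\<psi> b = 0"
      then show "\<exists>a ra b'. \<psi> b' = 0 \<and> X r d * X s b - X s b * X r d = a *\<^sub>C X ra b'"
        unfolding X_X by (intro exI[of _ "of_int (symp r s)"] exI[of _ "r + s"] exI[of _ "d * b"]) simp
    qed
    show "app (E (tmon r \<otimes>\<^sub>C d)) w \<in> ?K"
    proof (rule stable[OF _ w])
      fix s b assume b: "\<psi> b = 0"
      have "E (tmon r \<otimes>\<^sub>C d) * X s b - X s b * E (tmon r \<otimes>\<^sub>C d) = 0 *\<^sub>C X s b"
        using X_tmon[of s b r d] b by simp
      then show "\<exists>a ra b'. \<psi> b' = 0 \<and> E (tmon r \<otimes>\<^sub>C d) * X s b - X s b * E (tmon r \<otimes>\<^sub>C d) = a *\<^sub>C X ra b'"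
        using b by blast
    qed
  next
    fix i d w assume w: "w \<in> ?K"
    show "app (H i d) w \<in> ?K"
    proof (rule stable[OF _ w])
      fix s b assume "\<psi> b = 0"
      then show "\<exists>a r b'. \<psi> b' = 0 \<and> H i d * X s b - X s b * H i d = a *\<^sub>C X r b'"
        unfolding H_X by (intro exI[of _ "of_int (s $ i)"] exI[of _ s] exI[of _ "d * b"]) simp
    qed
  qed
  show ?thesis by (rule endo_eqI) (use K b in simp)
qed

lemma X_psi: "X s b = \<psi> b *\<^sub>C X s 1"
proof -
  have "X s (b - \<psi> b *\<^sub>C 1) = 0" by (rule X_eq_0) simp
  then show ?thesis using X_add[of s "b - \<psi> b *\<^sub>C 1" "\<psi> b *\<^sub>C 1"] by (simp add: X_scale)
qed

end

theorem lemma4p10: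
  fixes \<rho> :: "('m::finite ham_laurent, 'b::complex_comm_algebra) tensor
                \<Rightarrow> 'v::complex_vector \<Rightarrow> 'v"
    and \<psi> :: "'b \<Rightarrow> complex"
  assumes "finitely_generated_algebra TYPE('b)"
    and "irreducible_lie_module \<rho>"
    and "uniformly_bounded_HC_module \<rho>"
    and "\<exists>v. \<rho> (tmon 0 \<otimes>\<^sub>C 1) v \<noteq> 0"
    and "\<exists>s. s \<noteq> 0 \<and> (\<exists>v. \<rho> (tmon s \<otimes>\<^sub>C 1) v \<noteq> 0)"
    and "algebra_hom \<psi>"
    and "\<forall>r b v. r \<noteq> 0 \<longrightarrow> \<rho> (tmon r \<otimes>\<^sub>C b) v = \<psi> b *\<^sub>C \<rho> (tmon r \<otimes>\<^sub>C 1) v"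
  shows "\<forall>r b v. \<rho> (hamD r \<otimes>\<^sub>C b) v = \<psi> b *\<^sub>C \<rho> (hamD r \<otimes>\<^sub>C 1) v"
proof (intro allI)
  fix r b v
  interpret ham_module \<rho> \<psi> using assms by unfold_locales blast+
  have "app (X r b) v = app (\<psi> b *\<^sub>C X r 1) v" by (simp only: X_psi[of r b])
  then show "\<rho> (hamD r \<otimes>\<^sub>C b) v = \<psi> b *\<^sub>C \<rho> (hamD r \<otimes>\<^sub>C 1) v" by (simp add: X_def)
qed

end
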